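(* Assume that $\Lambda(x)=\lambda(x)\,\mathrm{Id}$ with $\lambda(x)\in\mathbf{R}$, and that the mesh and the points $(x_K)_{K\in\mathcal M}$ form a super-admissible discretization, i.e. for all $K\in\mathcal M$ and all $\sigma\in\mathcal E_K$, $$\mathbf n_{K,\sigma}=\frac{\bar x_\sigma-x_K}{d_{K,\sigma}}.$$ Let $\lambda_K$ be the mean value of $\lambda$ on $K$. Consider either (a) the Generalized Hybrid scheme with points $(x_K)_K$ and the diagonal matrices $\mathbb B^H_K$ with $\mathbb B^H_{K,\sigma,\sigma}=\frac{|\sigma|\lambda_K}{d_{K,\sigma}}$, $\mathbb B^H_{K,\sigma,\sigma'}=0$ for $\sigma\ne\sigma'$; or (b) the Modified Mixed scheme with points $(x_K)_K$ and the diagonal matrices $\mathbb B^M_K$ with $\mathbb B^M_{K,\sigma,\sigma}=|\sigma|\frac{d_{K,\sigma}}{\lambda_K}$, $\mathbb B^M_{K,\sigma,\sigma'}=0$ for $\sigma\neq\sigma'$. Then in both cases the scheme is a two-point flux scheme: any solution $(\widetilde p,F)$ satisfies $F_{K,\sigma}=\frac{\lambda_K}{d_{K,\sigma}}(p_K-p_\sigma)$ for all $K\in\mathcal M$, $\sigma\in\mathcal E_K$, and, for every interior face $\sigma$ between the cells $K$ and $L$, $$F_{K,\sigma}=\frac{\lambda_K\lambda_L}{d_{K,\sigma}\lambda_L+d_{L,\sigma}\lambda_K}(p_K-p_L).$$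
   Context: **Problem.** $\Omega\subset\mathbf{R}^d$ is a bounded (polytopal) open set, $f\in L^2(\Omega)$, $\Lambda:\Omega\to M_d(\mathbf{R})$ is bounded, measurable, symmetric and uniformly elliptic ($\Lambda(x)\xi\cdot\xi\ge\zeta|\xi|^2$ for some $\zeta>0$, a.e. $x$, all $\xi$). **Mesh.** $\mathcal M$ is a finite partition (up to a null set) of $\Omega$ into open polytopal cells $K$. $\mathcal E_K$ is the set of faces of $K$ (relatively open subsets of hyperplanes, disjoint, contained in $\partial K$, with closures covering $\partial K$); $\mathcal E$ is the set of all faces; each face is either contained in $\partial\Omega$ or interior, i.e. common to exactly two cells. $|K|,|\sigma|$ are measures, $\mathbf n_{K,\sigma}$ is the unit normal to $\sigma$ outward to $K$, $\bar x_\sigma$ the center of gravity of $\sigma$, $x_K\in K$ a chosen point, $d_{K,\sigma}>0$ the distance from $x_K$ to the hyperplane containing $\sigma$, $\Lambda_K$ the mean of $\Lambda$ on $K$ (here $\Lambda_K=\lambda_K\mathrm{Id}$). **Spaces.** $\widetilde H_{\mathcal M,0}$: families $\widetilde p=((p_K)_{K\in\mathcal M},(p_\sigma)_{\sigma\in\mathcal E})$ with $p_\sigma=0$ if $\sigma\subset\partial\Omega$. $\widetilde H_K$: local families $\widetilde p_K=(p_K,(p_\sigma)_{\sigma\in\mathcal E_K})$. $\mathcal F$: families $F=(F_{K,\sigma})_{K\in\mathcal M,\sigma\in\mathcal E_K}$ with $F_{K,\sigma}+F_{L,\sigma}=0$ for each interior face common to $K,L$; $F_K=(F_{K,\sigma})_{\sigma\in\mathcal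 E_K}\in\mathcal F_K=\mathbf{R}^{\mathcal E_K}$. **Generalized Hybrid scheme.** Set $\nabla_K\widetilde p_K=\frac1{|K|}\sum_{\sigma\in\mathcal E_K}|\sigma|(p_\sigma-p_K)\mathbf n_{K,\sigma}$, $S_{K,\sigma}(\widetilde p_K)=p_\sigma-p_K-\nabla_K\widetilde p_K\cdot(\bar x_\sigma-x_K)$. Find $(\widetilde p,F)\in\widetilde H_{\mathcal M,0}\times\mathcal F$ such that for all $K$: $\sum_{\sigma\in\mathcal E_K}|\sigma|F_{K,\sigma}=\int_Kf$, and for all $\widetilde q_K\in\widetilde H_K$, $\sum_{\sigma\in\mathcal E_K}|\sigma|F_{K,\sigma}(q_K-q_\sigma)=|K|\Lambda_K\nabla_K\widetilde p_K\cdot\nabla_K\widetilde q_K+S_K(\widetilde q_K)^T\mathbb B^H_KS_K(\widetilde p_K)$. **Modified Mixed scheme.** Set $|K|\Lambda_K\mathbf v_K(F_K)=-\sum_{\sigma\in\mathcal E_K}|\sigma|F_{K,\sigma}(\bar x_\sigma-x_K)$, $T_{K,\sigma}(F_K)=F_{K,\sigma}+\Lambda_K\mathbf v_K(F_K)\cdot\mathbf n_{K,\sigma}$. Find $(\widetilde p,F)\in\widetilde H_{\mathcal M,0}\times\mathcal F$ such that for all $K$: $\sum_{\sigma\in\mathcal E_K}|\sigma|F_{K,\sigma}=\int_Kf$, and for all $G_K\in\mathcal F_K$, $|K|\mathbf v_K(F_K)\cdot\Lambda_K\mathbf v_K(G_K)+T_K(G_K)^T\mathbb B^M_KT_K(F_K)=\sum_{\sigma\in\mathcal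 E_K}(p_K-p_\sigma)|\sigma|G_{K,\sigma}$.
   Formalization: The faces are additionally assumed polytopal (relative boundary in finitely many lower-dimensional affine subspaces), since for merely relatively open faces, whose boundary may have positive measure, the claim fails; each face is also assumed to have a well-defined outward unit normal. *)

theory Defs
  imports "HOL-Analysis.Analysis"
begin

section \<open>Polytopal sets, hyperplane measure\<close>

text \<open>A bounded relatively open set is polytopal if its relative boundary is flat, i.e. covered by
  finitely many affine subspaces of smaller dimension.  The sets need not be convex or connected.
  The same notion serves for the domain and the cells (affine hull: the whole space) and for
  the faces (affine hull: a hyperplane).  For faces it excludes relatively open sets whose relative
  boundary has positive measure.\<close>

definition polytopal :: "'a::euclidean_space set \<Rightarrow> bool" where
  "polytopal S \<longleftrightarrow>
     bounded S \<and> openin (top_of_set (affine hull S)) S \<and>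
     (\<exists>\<A>. finite \<A> \<and> (\<forall>A\<in>\<A>. affine A \<and> aff_dim A < aff_dim S) \<and> rel_frontier S \<subseteq> \<Union>\<A>)"

text \<open>The \<open>(d-1)\<close>-dimensional Lebesgue measure on an affine hyperplane \<open>H\<close>.  In orthonormal
  coordinates adapted to \<open>H\<close>, Lebesgue measure is the product of the measure on \<open>H\<close> and the
  length in the normal direction; hence the measure on \<open>H\<close> is the image, under the orthogonal
  projection onto \<open>H\<close>, of Lebesgue measure on the slab of total thickness 1 around \<open>H\<close>.
  (For \<open>d = 1\<close> it is the unit mass at the point \<open>H\<close>.)\<close>

definition hyperplane_measure :: "'a::euclidean_space set \<Rightarrow> 'a measure" where
  "hyperplane_measure H =
     distr (restrict_space lborel {x. infdist x H \<le> 1 / 2}) borel (closest_point H)"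

definition face_area :: "'a::euclidean_space set \<Rightarrow> real" where
  "face_area \<sigma> = measure (hyperplane_measure (affine hull \<sigma>)) \<sigma>"

definition face_center :: "'a::euclidean_space set \<Rightarrow> 'a" where
  "face_center \<sigma> =
     (1 / face_area \<sigma>) *\<^sub>R (LINT x:\<sigma>|hyperplane_measure (affine hull \<sigma>). x)"

definition volume :: "'a::euclidean_space set \<Rightarrow> real" where
  "volume K = measure lebesgue K"

definition mean_value ::
  "'a::euclidean_space set \<Rightarrow> ('a \<Rightarrow> 'b::{banach, second_countable_topology}) \<Rightarrow> 'b" where
  "mean_value K g = (1 / volume K) *\<^sub>R (LINT x:K|lebesgue. g x)"

section \<open>Data of the problem\<close>

definition square_integrable_on :: "('a::euclidean_space \<Rightarrow> real) \<Rightarrow> 'a set \<Rightarrow> bool" where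
  "square_integrable_on f \<Omega> \<longleftrightarrow>
     set_borel_measurable lebesgue \<Omega> f \<and> set_integrable lebesgue \<Omega> (\<lambda>x. (f x)\<^sup>2)"

definition diffusion_tensor :: "(real^'d) set \<Rightarrow> (real^'d \<Rightarrow> real^'d^'d) \<Rightarrow> bool" where
  "diffusion_tensor \<Omega> \<Lambda> \<longleftrightarrow>
     set_borel_measurable lebesgue \<Omega> \<Lambda> \<and> bounded (\<Lambda> ` \<Omega>) \<and>
     (\<forall>x\<in>\<Omega>. transpose (\<Lambda> x) = \<Lambda> x) \<and>
     (\<exists>\<zeta>>0. AE x in lebesgue. x \<in> \<Omega> \<longrightarrow> (\<forall>\<xi>. (\<Lambda> x *v \<xi>) \<bullet> \<xi> \<ge> \<zeta> * (norm \<xi>)\<^sup>2))"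

section \<open>Mesh\<close>

text \<open>A mesh is given by its set of cells \<open>\<M>\<close> and the map \<open>\<E>\<close> sending a cell to the set of its
  faces.  Cells and faces are sets of points, so they index the unknowns directly.\<close>

type_synonym 'd cell = "(real^'d) set"
type_synonym 'd face = "(real^'d) set"

text \<open>The position of \<open>K\<close> relative to \<open>\<sigma>\<close> is tested at those points of \<open>\<sigma>\<close> near which the boundary
  of \<open>K\<close> consists of \<open>\<sigma>\<close> alone.  At exceptional points of \<open>\<sigma>\<close>, another part of the
  boundary of a non-convex cell may touch \<open>\<sigma>\<close>.\<close>

definition is_outward_unit_normal :: "'d cell \<Rightarrow> 'd face \<Rightarrow> real^'d \<Rightarrow> bool" where
  "is_outward_unit_normal K \<sigma> n \<longleftrightarrow>
     norm n = 1 \<and> (\<exists>c. \<sigma> \<subseteq> {x. n \<bullet> x = c}) \<and>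
     (\<forall>x\<in>\<sigma>. (\<exists>\<epsilon>>0. ball x \<epsilon> \<inter> frontier K \<subseteq> \<sigma>) \<longrightarrow>
        (\<exists>\<epsilon>>0. ball x \<epsilon> \<inter> K = {y \<in> ball x \<epsilon>. n \<bullet> (y - x) < 0}))"

definition normal :: "'d cell \<Rightarrow> 'd face \<Rightarrow> real^'d" where
  "normal K \<sigma> = (THE n. is_outward_unit_normal K \<sigma> n)"

definition polytopal_mesh ::
  "(real^'d) set \<Rightarrow> 'd cell set \<Rightarrow> ('d cell \<Rightarrow> 'd face set) \<Rightarrow> bool" where
  "polytopal_mesh \<Omega> \<M> \<E> \<longleftrightarrow>
     finite \<M> \<and> disjoint \<M> \<and> negligible (\<Omega> - \<Union>\<M>) \<and>
     (\<forall>K\<in>\<M>. K \<noteq> {} \<and> open K \<and> polytopal K \<and> K \<subseteq> \<Omega>) \<and>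
     (\<forall>K\<in>\<M>. finite (\<E> K) \<and> disjoint (\<E> K) \<and>
        \<Union>(\<E> K) \<subseteq> frontier K \<and> frontier K \<subseteq> (\<Union>\<sigma>\<in>\<E> K. closure \<sigma>) \<and>
        (\<forall>\<sigma>\<in>\<E> K. polytopal \<sigma> \<and> aff_dim \<sigma> = int CARD('d) - 1 \<and>
                  (\<exists>n. is_outward_unit_normal K \<sigma> n))) \<and>
     (\<forall>\<sigma>\<in>(\<Union>K\<in>\<M>. \<E> K). \<sigma> \<subseteq> frontier \<Omega> \<or> card {K\<in>\<M>. \<sigma> \<in> \<E> K} = 2)"

definition interior_face_between ::
  "(real^'d) set \<Rightarrow> 'd cell set \<Rightarrow> ('d cell \<Rightarrow> 'd face set) \<Rightarrow>
   'd face \<Rightarrow> 'd cell \<Rightarrow> 'd cell \<Rightarrow> bool" where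
  "interior_face_between \<Omega> \<M> \<E> \<sigma> K L \<longleftrightarrow>
     K \<in> \<M> \<and> L \<in> \<M> \<and> K \<noteq> L \<and> \<sigma> \<in> \<E> K \<and> \<sigma> \<in> \<E> L \<and> \<not> \<sigma> \<subseteq> frontier \<Omega>"

text \<open>The distance \<open>d\<^bsub>K,\<sigma>\<^esub>\<close>, as a function of the point of the cell.\<close>

definition face_dist :: "real^'d \<Rightarrow> 'd face \<Rightarrow> real" where
  "face_dist a \<sigma> = infdist a (affine hull \<sigma>)"

definition cell_points ::
  "'d cell set \<Rightarrow> ('d cell \<Rightarrow> 'd face set) \<Rightarrow> ('d cell \<Rightarrow> real^'d) \<Rightarrow> bool" where
  "cell_points \<M> \<E> xc \<longleftrightarrow> (\<forall>K\<in>\<M>. xc K \<in> K \<and> (\<forall>\<sigma>\<in>\<E> K. face_dist (xc K) \<sigma> > 0))"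

definition super_admissible ::
  "'d cell set \<Rightarrow> ('d cell \<Rightarrow> 'd face set) \<Rightarrow> ('d cell \<Rightarrow> real^'d) \<Rightarrow> bool" where
  "super_admissible \<M> \<E> xc \<longleftrightarrow>
     (\<forall>K\<in>\<M>. \<forall>\<sigma>\<in>\<E> K.
        normal K \<sigma> = (1 / face_dist (xc K) \<sigma>) *\<^sub>R (face_center \<sigma> - xc K))"

section \<open>Discrete spaces\<close>

text \<open>Families indexed by cells or faces are total functions whose values outside the mesh
  are irrelevant.  A local family on \<open>K\<close> is a pair of a cell value and a function of the faces.\<close>

type_synonym 'd family = "('d cell \<Rightarrow> real) \<times> ('d face \<Rightarrow> real)"
type_synonym 'd local_family = "real \<times> ('d face \<Rightarrow> real)"
type_synonym 'd fluxes = "'d cell \<Rightarrow> 'd face \<Rightarrow> real"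

definition localize :: "'d family \<Rightarrow> 'd cell \<Rightarrow> 'd local_family" where
  "localize p K = (fst p K, snd p)"

definition hybrid_space ::
  "(real^'d) set \<Rightarrow> 'd cell set \<Rightarrow> ('d cell \<Rightarrow> 'd face set) \<Rightarrow> 'd family set" where
  "hybrid_space \<Omega> \<M> \<E> = {p. \<forall>\<sigma>\<in>(\<Union>K\<in>\<M>. \<E> K). \<sigma> \<subseteq> frontier \<Omega> \<longrightarrow> snd p \<sigma> = 0}"

definition flux_space ::
  "(real^'d) set \<Rightarrow> 'd cell set \<Rightarrow> ('d cell \<Rightarrow> 'd face set) \<Rightarrow> 'd fluxes set" where
  "flux_space \<Omega> \<M> \<E> =
     {F. \<forall>\<sigma> K L. interior_face_between \<Omega> \<M> \<E> \<sigma> K L \<longrightarrow> F K \<sigma> + F L \<sigma> = 0}"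

definition flux_balance ::
  "'d cell set \<Rightarrow> ('d cell \<Rightarrow> 'd face set) \<Rightarrow> (real^'d \<Rightarrow> real) \<Rightarrow> 'd fluxes \<Rightarrow> bool" where
  "flux_balance \<M> \<E> f F \<longleftrightarrow>
     (\<forall>K\<in>\<M>. (\<Sum>\<sigma>\<in>\<E> K. face_area \<sigma> * F K \<sigma>) = (LINT x:K|lebesgue. f x))"

definition matrix_form ::
  "'i set \<Rightarrow> ('i \<Rightarrow> real) \<Rightarrow> ('i \<Rightarrow> 'i \<Rightarrow> real) \<Rightarrow> ('i \<Rightarrow> real) \<Rightarrow> real" where
  "matrix_form I u B v = (\<Sum>i\<in>I. \<Sum>j\<in>I. u i * B i j * v j)"

section \<open>Generalized Hybrid scheme\<close>

definition grad :: "('d cell \<Rightarrow> 'd face set) \<Rightarrow> 'd cell \<Rightarrow> 'd local_family \<Rightarrow> real^'d" where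
  "grad \<E> K p =
     (1 / volume K) *\<^sub>R (\<Sum>\<sigma>\<in>\<E> K. (face_area \<sigma> * (snd p \<sigma> - fst p)) *\<^sub>R normal K \<sigma>)"

definition hybrid_residual ::
  "('d cell \<Rightarrow> 'd face set) \<Rightarrow> ('d cell \<Rightarrow> real^'d) \<Rightarrow> 'd cell \<Rightarrow> 'd local_family \<Rightarrow>
   'd face \<Rightarrow> real" where
  "hybrid_residual \<E> xc K p \<sigma> =
     snd p \<sigma> - fst p - grad \<E> K p \<bullet> (face_center \<sigma> - xc K)"

definition generalized_hybrid_solution ::
  "(real^'d) set \<Rightarrow> (real^'d \<Rightarrow> real) \<Rightarrow> (real^'d \<Rightarrow> real^'d^'d) \<Rightarrow>
   'd cell set \<Rightarrow> ('d cell \<Rightarrow> 'd face set) \<Rightarrow> ('d cell \<Rightarrow> real^'d) \<Rightarrow>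
   ('d cell \<Rightarrow> 'd face \<Rightarrow> 'd face \<Rightarrow> real) \<Rightarrow> 'd family \<Rightarrow> 'd fluxes \<Rightarrow> bool" where
  "generalized_hybrid_solution \<Omega> f \<Lambda> \<M> \<E> xc BH p F \<longleftrightarrow>
     p \<in> hybrid_space \<Omega> \<M> \<E> \<and> F \<in> flux_space \<Omega> \<M> \<E> \<and> flux_balance \<M> \<E> f F \<and>
     (\<forall>K\<in>\<M>. \<forall>q :: 'd local_family.
        (\<Sum>\<sigma>\<in>\<E> K. face_area \<sigma> * F K \<sigma> * (fst q - snd q \<sigma>)) =
        volume K * ((mean_value K \<Lambda> *v grad \<E> K (localize p K)) \<bullet> grad \<E> K q)
        + matrix_form (\<E> K) (hybrid_residual \<E> xc K q) (BH K)
            (hybrid_residual \<E> xc K (localize p K)))"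

section \<open>Modified Mixed scheme\<close>

definition flux_vector ::
  "(real^'d \<Rightarrow> real^'d^'d) \<Rightarrow> ('d cell \<Rightarrow> 'd face set) \<Rightarrow> ('d cell \<Rightarrow> real^'d) \<Rightarrow> 'd cell \<Rightarrow>
   ('d face \<Rightarrow> real) \<Rightarrow> real^'d" where
  "flux_vector \<Lambda> \<E> xc K G =
     (THE v. volume K *\<^sub>R (mean_value K \<Lambda> *v v) =
        - (\<Sum>\<sigma>\<in>\<E> K. (face_area \<sigma> * G \<sigma>) *\<^sub>R (face_center \<sigma> - xc K)))"

definition mixed_residual ::
  "(real^'d \<Rightarrow> real^'d^'d) \<Rightarrow> ('d cell \<Rightarrow> 'd face set) \<Rightarrow> ('d cell \<Rightarrow> real^'d) \<Rightarrow> 'd cell \<Rightarrow>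
   ('d face \<Rightarrow> real) \<Rightarrow> 'd face \<Rightarrow> real" where
  "mixed_residual \<Lambda> \<E> xc K G \<sigma> =
     G \<sigma> + (mean_value K \<Lambda> *v flux_vector \<Lambda> \<E> xc K G) \<bullet> normal K \<sigma>"

definition modified_mixed_solution ::
  "(real^'d) set \<Rightarrow> (real^'d \<Rightarrow> real) \<Rightarrow> (real^'d \<Rightarrow> real^'d^'d) \<Rightarrow>
   'd cell set \<Rightarrow> ('d cell \<Rightarrow> 'd face set) \<Rightarrow> ('d cell \<Rightarrow> real^'d) \<Rightarrow>
   ('d cell \<Rightarrow> 'd face \<Rightarrow> 'd face \<Rightarrow> real) \<Rightarrow> 'd family \<Rightarrow> 'd fluxes \<Rightarrow> bool" where
  "modified_mixed_solution \<Omega> f \<Lambda> \<M> \<E> xc BM p F \<longleftrightarrow>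
     p \<in> hybrid_space \<Omega> \<M> \<E> \<and> F \<in> flux_space \<Omega> \<M> \<E> \<and> flux_balance \<M> \<E> f F \<and>
     (\<forall>K\<in>\<M>. \<forall>G :: 'd face \<Rightarrow> real.
        volume K * (flux_vector \<Lambda> \<E> xc K (F K) \<bullet>
                    (mean_value K \<Lambda> *v flux_vector \<Lambda> \<E> xc K G))
        + matrix_form (\<E> K) (mixed_residual \<Lambda> \<E> xc K G) (BM K)
            (mixed_residual \<Lambda> \<E> xc K (F K)) =
        (\<Sum>\<sigma>\<in>\<E> K. (fst p K - snd p \<sigma>) * face_area \<sigma> * G \<sigma>))"

end

theory Submission
  imports Defs
begin

text \<open>Everything rests on the identity
  \<open>\<Sum>\<sigma> |\<sigma>| d\<^sub>\<sigma> (n\<^sub>\<sigma> \<bullet> u) (n\<^sub>\<sigma> \<bullet> v) = |K| (u \<bullet> v)\<close> for super-admissible cells: with it the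
  gradient terms of either bilinear form cancel against the stabilisation, which leaves a
  diagonal form, and testing with the indicator of one face gives the two-point flux.

  Being symmetric, the identity need only be checked for \<open>u = v = e\<close> with \<open>e\<close> a unit vector.
  Along almost every line parallel to \<open>e\<close> the indicator of \<open>K\<close> jumps exactly at transversal
  crossings of single faces, so it equals the sum over the faces of \<open>sgn (n\<^sub>\<sigma> \<bullet> e)\<close>
  times the indicator of the shadow \<open>\<sigma> - [0,\<infinity>) e\<close>.  Cutting the shadows at \<open>x \<bullet> e = -R\<close> and
  computing the volumes of the resulting prisms gives
  \<open>|K| = \<Sum>\<sigma> |\<sigma>| (n\<^sub>\<sigma> \<bullet> e) (c\<^sub>\<sigma> \<bullet> e + R)\<close>, where \<open>c\<^sub>\<sigma>\<close> is the center of gravity of \<open>\<sigma>\<close>,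
  for all large \<open>R\<close>, whence also \<open>\<Sum>\<sigma> |\<sigma>| (n\<^sub>\<sigma> \<bullet> e) = 0\<close>.\<close>

section \<open>Well-ordered index types\<close>

text \<open>The change of variables theorem of the library needs a well-ordered index type; a copy of the
  index type, well-ordered through an injection into the naturals, supplies one.\<close>

typedef 'a wo_index = "UNIV :: 'a set"
  by blast

lemma finite_wo_index: "finite (UNIV :: 'a::finite wo_index set)"
  unfolding type_definition.univ[OF type_definition_wo_index] by simp

instance wo_index :: (finite) finite
  by standard (rule finite_wo_index)

definition wo_rank :: "'a::finite wo_index \<Rightarrow> nat" where
  "wo_rank = (SOME g. inj g)"

lemma inj_wo_rank: "inj wo_rank"
proof -
  have "\<exists>g :: 'a wo_index \<Rightarrow> nat. inj g"
    using finite_imp_inj_to_nat_seg[OF finite_wo_index] by metis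
  then show ?thesis
    unfolding wo_rank_def by (rule someI_ex)
qed

instantiation wo_index :: (finite) wellorder
begin

definition less_eq_wo_index :: "'a wo_index \<Rightarrow> 'a wo_index \<Rightarrow> bool" where
  "less_eq_wo_index i j \<longleftrightarrow> wo_rank i \<le> wo_rank j"

definition less_wo_index :: "'a wo_index \<Rightarrow> 'a wo_index \<Rightarrow> bool" where
  "less_wo_index i j \<longleftrightarrow> wo_rank i < wo_rank j"

instance
proof
  fix P :: "'a wo_index \<Rightarrow> bool" and a
  assume step: "\<And>x. (\<And>y. y < x \<Longrightarrow> P y) \<Longrightarrow> P x"
  show "P a"
    by (rule wf_induct_rule[OF wf_measure[of wo_rank]]) (rule step, simp add: less_wo_index_def)
next
  fix i j :: "'a wo_index"
  assume "i \<le> j" "j \<le> i"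
  then show "i = j"
    by (intro injD[OF inj_wo_rank]) (simp add: less_eq_wo_index_def)
qed (simp_all add: less_eq_wo_index_def less_wo_index_def less_le_not_le linear)

end

section \<open>Determinant of a rank-one update of the identity\<close>

text \<open>The matrix determinant lemma, det (I + b a^T) = 1 + a . b. It supplies the Jacobian of
  the prism parametrisation in \<open>prism_volume_wellorder\<close>.\<close>

lemma det_rank_one_update:
  fixes a b :: "real^'n"
  shows "det (matrix (\<lambda>v. v + (a \<bullet> v) *\<^sub>R b)) = 1 + a \<bullet> b"
proof -
  fix k :: 'n
  \<comment> \<open>rotate \<open>a\<close> onto a coordinate axis: the update then changes one column of the identity only\<close>
  obtain T :: "real^'n \<Rightarrow> real^'n"
    where T: "orthogonal_transformation T" "T (norm a *\<^sub>R axis k 1) = a"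
    using orthogonal_transformation_exists[of "norm a *\<^sub>R axis k (1::real)" a]
    by (metis norm_axis_1 norm_scaleR abs_norm_cancel mult.right_neutral)
  have linT: "linear T" by (rule orthogonal_transformation_linear[OF T(1)])
  define b' where "b' = inv T b"
  have b: "T b' = b"
    unfolding b'_def by (rule surj_f_inv_f) (rule orthogonal_transformation_surj[OF T(1)])
  define g where "g = (\<lambda>v::real^'n. v + (v $ k * norm a) *\<^sub>R b')"
  have ing: "T x \<bullet> T y = x \<bullet> y" for x y
    using T(1) by (auto simp: orthogonal_transformation_def)
  have eq: "(\<lambda>v. v + (a \<bullet> v) *\<^sub>R b) \<circ> T = T \<circ> g"
  proof
    fix v
    have "a \<bullet> T v = norm a * v $ k"
      using ing[of "norm a *\<^sub>R axis k 1" v] by (simp add: T(2) inner_axis inner_commute)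
    then show "((\<lambda>v. v + (a \<bullet> v) *\<^sub>R b) \<circ> T) v = (T \<circ> g) v"
      by (simp add: g_def linear_add[OF linT] linear_scale[OF linT] b mult.commute)
  qed
  have lg: "linear g" unfolding g_def
    by (rule linearI) (auto simp: algebra_simps scaleR_add_left)
  have lf: "linear (\<lambda>v. v + (a \<bullet> v) *\<^sub>R b)"
    by (rule linearI) (auto simp: algebra_simps inner_add_right scaleR_add_left)
  have dT: "det (matrix T) \<noteq> 0"
    using orthogonal_transformation_det[OF T(1)] by auto
  have "det (matrix (\<lambda>v. v + (a \<bullet> v) *\<^sub>R b)) * det (matrix T) = det (matrix T) * det (matrix g)"
    using matrix_compose[OF linT lf] matrix_compose[OF lg linT] eq by (simp add: det_mul[symmetric])
  then have "det (matrix (\<lambda>v. v + (a \<bullet> v) *\<^sub>R b)) = det (matrix g)"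
    using dT by simp
  \<comment> \<open>Since \<open>g\<close> alters a vector only through its \<open>k\<close>-th
    coordinate, its matrix is the identity with column \<open>k\<close> replaced. Writing that
    column as a product with \<open>mat 1\<close> gives the shape in which Cramer's rule evaluates
    the determinant.\<close>
  also have "matrix g = (\<chi> i j. if j = k then ((mat 1 :: real^'n^'n) *v (axis k 1 + norm a *\<^sub>R b')) $ i else (mat 1 :: real^'n^'n) $ i $ j)"
    unfolding matrix_vector_mul_lid by (simp add: matrix_def g_def vec_eq_iff mat_def axis_def)
  also have "det \<dots> = (axis k 1 + norm a *\<^sub>R b') $ k * det (mat 1 :: real^'n^'n)"
    by (rule cramer_lemma)
  also have "\<dots> = 1 + norm a * b' $ k"
    by simp
  also have "norm a * b' $ k = a \<bullet> b"
    using ing[of "norm a *\<^sub>R axis k 1" b'] by (simp add: T(2) b inner_axis inner_commute)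
  finally show ?thesis .
qed

section \<open>Volumes of prisms\<close>

lemma borel_orthogonal_slab:
  fixes n :: "'a::euclidean_space"
  assumes "A \<in> sets borel"
  shows "{x. x - (n \<bullet> x - c) *\<^sub>R n \<in> A \<and> \<bar>n \<bullet> x - c\<bar> \<le> 1/2} \<in> sets borel"
proof -
  have [measurable]: "A \<in> sets borel" by fact
  show ?thesis by measurable
qed

lemma bounded_orthogonal_slab:
  fixes n :: "'a::euclidean_space"
  assumes "bounded A"
  shows "bounded {x. x - (n \<bullet> x - c) *\<^sub>R n \<in> A \<and> \<bar>n \<bullet> x - c\<bar> \<le> 1/2}"
proof -
  obtain B where B: "\<And>z. z \<in> A \<Longrightarrow> norm z \<le> B" using assms by (auto simp: bounded_iff)
  have "norm x \<le> B + norm n" if "x - (n \<bullet> x - c) *\<^sub>R n \<in> A" "\<bar>n \<bullet> x - c\<bar> \<le> 1/2" for x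
  proof -
    have "norm x \<le> norm (x - (n \<bullet> x - c) *\<^sub>R n) + norm ((n \<bullet> x - c) *\<^sub>R n)"
      by (metis diff_add_cancel norm_triangle_ineq)
    also have "norm ((n \<bullet> x - c) *\<^sub>R n) \<le> 1 * norm n"
      unfolding norm_scaleR by (rule mult_right_mono) (use that in auto)
    finally show ?thesis using B[OF that(1)] by simp
  qed
  then show ?thesis by (auto simp: bounded_iff)
qed

text \<open>A bounded set lies in a compact box, on which a continuous function is
  integrable.\<close>

lemma set_integrable_continuous_bounded:
  fixes f :: "'a::euclidean_space \<Rightarrow> 'b::{banach, second_countable_topology}"
  assumes f: "continuous_on UNIV f" and S: "S \<in> sets borel" "bounded S"
  shows "set_integrable lborel S f"
proof -
  obtain a where "S \<subseteq> cbox (-a) a"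
    using bounded_subset_cbox_symmetric[OF S(2)] by blast
  moreover have "set_integrable lborel (cbox (-a) a) f"
    using borel_integrable_compact[OF compact_cbox continuous_on_subset[OF f subset_UNIV]]
    by (simp add: set_integrable_def indicator_scaleR_eq_if)
  ultimately show ?thesis
    by (rule set_integrable_subset[rotated 2]) (use S in simp)
qed

text \<open>\<open>Q\<close> consists of the segments issuing from the points \<open>z\<close> of
  \<open>A\<close> in direction \<open>-e\<close> with parameter length
  \<open>z \<bullet> e + R\<close>; for a unit vector \<open>e\<close> they end on the plane x . e =
  -R. The map \<open>f\<close> sends the slab \<open>S\<close> bijectively onto \<open>Q\<close>:
  the foot \<open>P x\<close> is kept as the base point and the signed height over the hyperplane,
  shifted by 1/2, becomes the fraction of the segment. The volume then follows by change of
  variables.\<close>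

lemma prism_volume_wellorder:
  fixes n e :: "real^'n::{finite,wellorder}"
  assumes n: "norm n = 1" and ne: "n \<bullet> e \<noteq> 0"
    and A: "A \<in> sets borel" "bounded A" "A \<subseteq> {z. n \<bullet> z = c}"
    and pos: "\<And>z. z \<in> A \<Longrightarrow> 0 < z \<bullet> e + R"
  defines "S \<equiv> {x. x - (n \<bullet> x - c) *\<^sub>R n \<in> A \<and> \<bar>n \<bullet> x - c\<bar> \<le> 1/2}"
    and "Q \<equiv> {z - (r * (z \<bullet> e + R)) *\<^sub>R e | z r. z \<in> A \<and> 0 \<le> r \<and> r \<le> 1}"
  shows "Q \<in> lmeasurable"
    and "measure lebesgue Q =
      \<bar>n \<bullet> e\<bar> * (LINT x|lborel. indicator S x * ((x - (n \<bullet> x - c) *\<^sub>R n) \<bullet> e + R))"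
proof -
  define P where "P = (\<lambda>x. x - (n \<bullet> x - c) *\<^sub>R n)"
  define f where "f = (\<lambda>x. P x - ((n \<bullet> x - c + 1/2) * (P x \<bullet> e + R)) *\<^sub>R e)"
  \<comment> \<open>the derivative of \<open>f\<close> factors into two rank-one updates: stretching along \<open>n\<close> by the height
    of the prism, then shearing \<open>n\<close> onto \<open>-e\<close>\<close>
  define w where "w = (\<lambda>x. (P x \<bullet> e + R - 1) *\<^sub>R n + (n \<bullet> x - c + 1/2) *\<^sub>R (e - (n \<bullet> e) *\<^sub>R n))"
  define D1 where "D1 = (\<lambda>x v. v + (w x \<bullet> v) *\<^sub>R n)"
  define D2 where "D2 = (\<lambda>v. v + (n \<bullet> v) *\<^sub>R (- (n + e)))"
  have nn: "n \<bullet> n = 1" using n by (simp add: norm_eq_1)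
  have linD1: "linear (D1 x)" for x unfolding D1_def
    by (rule linearI) (auto simp: algebra_simps inner_add_right)
  have linD2: "linear D2" unfolding D2_def
    by (rule linearI) (auto simp: algebra_simps inner_add_right)
  have S: "S \<in> sets borel" unfolding S_def by (rule borel_orthogonal_slab[OF A(1)])
  have bS: "bounded S" unfolding S_def by (rule bounded_orthogonal_slab[OF A(2)])
  have Sm: "S \<in> lmeasurable" using bS S by (simp add: bounded_set_imp_lmeasurable)
  have der: "(f has_derivative D2 \<circ> D1 x) (at x within S)" for x
  proof -
    have "(f has_derivative (\<lambda>v. (v - (n \<bullet> v) *\<^sub>R n)
        - ((n \<bullet> v) * (P x \<bullet> e + R) + (n \<bullet> x - c + 1/2) * ((v - (n \<bullet> v) *\<^sub>R n) \<bullet> e)) *\<^sub>R e)) (at x within S)"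
      unfolding f_def P_def by (auto intro!: derivative_eq_intros simp: algebra_simps inner_diff_left)
    also have "(\<lambda>v. (v - (n \<bullet> v) *\<^sub>R n)
        - ((n \<bullet> v) * (P x \<bullet> e + R) + (n \<bullet> x - c + 1/2) * ((v - (n \<bullet> v) *\<^sub>R n) \<bullet> e)) *\<^sub>R e) = D2 \<circ> D1 x"
    proof
      fix v
      \<comment> \<open>\<open>t\<close> is the derivative along \<open>v\<close> of the length
        travelled in direction \<open>-e\<close>. \<open>D1 x\<close> gives \<open>v\<close> the
        normal component \<open>t\<close>, and \<open>D2\<close> then trades this component
        \<open>t *\<^sub>R n\<close> for \<open>- t *\<^sub>R e\<close>.\<close>
      define t where "t = (n \<bullet> v) * (P x \<bullet> e + R) + (n \<bullet> x - c + 1/2) * ((v - (n \<bullet> v) *\<^sub>R n) \<bullet> e)"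
      have w: "w x \<bullet> v = t - n \<bullet> v"
        by (simp add: w_def t_def algebra_simps inner_simps inner_commute)
      have "n \<bullet> D1 x v = t" by (simp add: D1_def w inner_add_right nn)
      then show "(v - (n \<bullet> v) *\<^sub>R n) - t *\<^sub>R e = (D2 \<circ> D1 x) v"
        by (simp add: D2_def) (simp add: D1_def w algebra_simps)
    qed
    finally show ?thesis .
  qed
  have det: "\<bar>det (matrix (D2 \<circ> D1 x))\<bar> = \<bar>n \<bullet> e\<bar> * (P x \<bullet> e + R)" if "x \<in> S" for x
  proof -
    have "w x \<bullet> n = P x \<bullet> e + R - 1"
      by (simp add: w_def inner_simps nn inner_commute)
    then have "det (matrix (D1 x)) = P x \<bullet> e + R"
      unfolding D1_def by (subst det_rank_one_update) simp
    moreover have "det (matrix D2) = - (n \<bullet> e)"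
      unfolding D2_def by (subst det_rank_one_update) (simp add: inner_simps nn)
    moreover have "P x \<bullet> e + R > 0" using that pos by (auto simp: S_def P_def)
    ultimately show ?thesis
      using matrix_compose[OF linD1 linD2] by (simp add: det_mul abs_mult)
  qed
  have inj: "inj_on f S"
  proof (rule inj_onI)
    fix x y assume x: "x \<in> S" and y: "y \<in> S" and eq: "f x = f y"
    have PA: "P x \<in> A" "P y \<in> A" using x y by (auto simp: S_def P_def)
    then have "n \<bullet> P x = n \<bullet> P y" using A(3) by auto
    \<comment> \<open>Both feet have the same \<open>n\<close>-component, so the
      \<open>n\<close>-component of \<open>f x = f y\<close> compares only the displacements along
      \<open>e\<close>, which is transversal to the hyperplane.\<close>
    then have r: "(n \<bullet> x - c + 1/2) * (P x \<bullet> e + R) = (n \<bullet> y - c + 1/2) * (P y \<bullet> e + R)"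
      using arg_cong[OF eq, of "\<lambda>z. n \<bullet> z"] ne by (simp add: f_def inner_simps)
    then have P: "P x = P y" using eq by (simp add: f_def)
    moreover have "P y \<bullet> e + R \<noteq> 0" using pos[OF PA(2)] by simp
    ultimately have "n \<bullet> x = n \<bullet> y" using r by simp
    with P show "x = y" by (simp add: P_def)
  qed
  have im: "f ` S = Q"
  proof (intro equalityI subsetI)
    fix y assume "y \<in> f ` S"
    then obtain x where x: "x \<in> S" "y = f x" by auto
    have "P x \<in> A" "0 \<le> n \<bullet> x - c + 1/2" "n \<bullet> x - c + 1/2 \<le> 1"
      using x(1) abs_le_D1[of "n \<bullet> x - c" "1/2"] abs_le_D2[of "n \<bullet> x - c" "1/2"]
      by (simp_all add: S_def P_def)
    then show "y \<in> Q" unfolding Q_def x(2) f_def by blast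
  next
    fix y assume "y \<in> Q"
    then obtain z r where z: "z \<in> A" "0 \<le> r" "r \<le> 1" "y = z - (r * (z \<bullet> e + R)) *\<^sub>R e"
      by (auto simp: Q_def)
    \<comment> \<open>The preimage of \<open>y\<close> is the point over \<open>z\<close> at signed
      height \<open>r - 1/2\<close>.\<close>
    have nx: "n \<bullet> (z + (r - 1/2) *\<^sub>R n) - c = r - 1/2"
      using z(1) A(3) by (auto simp: inner_simps nn)
    then have Px: "P (z + (r - 1/2) *\<^sub>R n) = z" by (simp add: P_def)
    have "\<bar>r - 1/2\<bar> \<le> 1/2" using z(2,3) by (intro abs_leI) auto
    then have "z + (r - 1/2) *\<^sub>R n \<in> S"
      using Px nx z(1) by (simp add: S_def P_def)
    moreover have "f (z + (r - 1/2) *\<^sub>R n) = y"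
      unfolding f_def Px nx z(4) by simp
    ultimately show "y \<in> f ` S" by blast
  qed
  have cont: "continuous_on UNIV (\<lambda>x. \<bar>n \<bullet> e\<bar> * (P x \<bullet> e + R))"
    unfolding P_def by (intro continuous_intros)
  have "set_integrable lborel S (\<lambda>x. \<bar>n \<bullet> e\<bar> * (P x \<bullet> e + R))"
    by (rule set_integrable_continuous_bounded[OF cont S bS])
  note hi = set_borel_integral_eq_integral[OF this]
  have int: "(\<lambda>x. \<bar>det (matrix (D2 \<circ> D1 x))\<bar>) integrable_on S"
    using hi(1) by (rule integrable_eq) (simp add: det)
  show "Q \<in> lmeasurable"
    using measurable_differentiable_image_eq[OF _ der inj] int Sm im by auto
  have "measure lebesgue (f ` S) = integral S (\<lambda>x. \<bar>det (matrix (D2 \<circ> D1 x))\<bar>)"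
    by (rule measure_differentiable_image_eq[OF _ der inj int]) (use Sm in auto)
  also have "\<dots> = integral S (\<lambda>x. \<bar>n \<bullet> e\<bar> * (P x \<bullet> e + R))"
    by (rule integral_cong) (simp add: det)
  also have "\<dots> = (LINT x|lborel. \<bar>n \<bullet> e\<bar> * (indicator S x * (P x \<bullet> e + R)))"
    unfolding hi(2)[symmetric] set_lebesgue_integral_def
    by (intro Bochner_Integration.integral_cong) (auto simp: ac_simps)
  finally show "measure lebesgue Q =
      \<bar>n \<bullet> e\<bar> * (LINT x|lborel. indicator S x * ((x - (n \<bullet> x - c) *\<^sub>R n) \<bullet> e + R))"
    by (simp add: im P_def)
qed

section \<open>Relabelling coordinates by the well-ordered index type\<close>

definition wo_vec :: "real^'d \<Rightarrow> real^'d wo_index" where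
  "wo_vec x = (\<chi> i. x $ Rep_wo_index i)"

definition unwo_vec :: "real^'d wo_index \<Rightarrow> real^'d" where
  "unwo_vec x = (\<chi> i. x $ Abs_wo_index i)"

lemma bij_Rep_wo_index: "bij Rep_wo_index"
  using Rep_wo_index_inject Rep_wo_index_inverse Abs_wo_index_inverse
  by (intro bijI injI surjI[where f=Abs_wo_index]) auto

lemma unwo_vec_wo_vec [simp]: "unwo_vec (wo_vec x) = x"
  by (simp add: unwo_vec_def wo_vec_def vec_eq_iff Abs_wo_index_inverse)

lemma wo_vec_unwo_vec [simp]: "wo_vec (unwo_vec x) = x"
  by (simp add: unwo_vec_def wo_vec_def vec_eq_iff Rep_wo_index_inverse)

lemma linear_wo_vec: "linear wo_vec"
  by (rule linearI) (simp_all add: wo_vec_def vec_eq_iff)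

lemma linear_unwo_vec: "linear unwo_vec"
  by (rule linearI) (simp_all add: unwo_vec_def vec_eq_iff)

lemma inner_wo_vec [simp]: "wo_vec x \<bullet> wo_vec y = x \<bullet> (y :: real^'d)"
  unfolding inner_vec_def wo_vec_def
  using sum.reindex_bij_betw[OF bij_Rep_wo_index, of "\<lambda>i. x $ i \<bullet> y $ i"] by simp

lemma borel_measurable_wo_vec [measurable]: "wo_vec \<in> borel_measurable borel"
  by (intro borel_measurable_continuous_onI linear_continuous_on linear_conv_bounded_linear[THEN iffD1] linear_wo_vec)

lemma borel_measurable_unwo_vec [measurable]: "unwo_vec \<in> borel_measurable borel"
  by (intro borel_measurable_continuous_onI linear_continuous_on linear_conv_bounded_linear[THEN iffD1] linear_unwo_vec)

lemma prod_Basis_cart: "(\<Prod>b\<in>Basis. (x :: real^'n) \<bullet> b) = (\<Prod>i\<in>UNIV. x $ i)"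
proof -
  have "(\<Prod>b\<in>Basis. x \<bullet> b) = (\<Prod>b\<in>range (\<lambda>i :: 'n. axis i (1::real)). x \<bullet> b)"
    by (rule prod.cong) (auto simp: Basis_vec_def)
  also have "\<dots> = (\<Prod>i\<in>UNIV. x \<bullet> axis i 1)"
    by (rule prod.reindex_cong[where l="\<lambda>i. axis i 1"]) (auto intro!: inj_onI simp: axis_eq_axis)
  finally show ?thesis by (simp add: inner_axis)
qed

text \<open>Lebesgue measure is determined by its values on boxes, and relabelling the coordinates
  only permutes the factors in the volume of a box.\<close>

lemma lborel_distr_wo_vec: "distr lborel borel (wo_vec :: real^'d \<Rightarrow> _) = lborel"
proof (rule lborel_eqI[symmetric])
  fix l u :: "real^'d wo_index"
  assume "\<And>b. b \<in> Basis \<Longrightarrow> l \<bullet> b \<le> u \<bullet> b"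
  then have le: "l $ i \<le> u $ i" for i
    by (simp add: cart_eq_inner_axis axis_in_Basis_iff)
  have eq: "wo_vec -` box l u = box (unwo_vec l) (unwo_vec u)"
  proof (intro set_eqI)
    fix x :: "real^'d"
    have "(\<forall>i. l $ i < x $ Rep_wo_index i \<and> x $ Rep_wo_index i < u $ i) \<longleftrightarrow>
      (\<forall>i. l $ Abs_wo_index i < x $ i \<and> x $ i < u $ Abs_wo_index i)"
      by (metis Abs_wo_index_inverse Rep_wo_index_inverse UNIV_I)
    then show "x \<in> wo_vec -` box l u \<longleftrightarrow> x \<in> box (unwo_vec l) (unwo_vec u)"
      by (simp add: mem_box_cart wo_vec_def unwo_vec_def)
  qed
  have "emeasure (distr lborel borel wo_vec) (box l u)
      = emeasure lborel (box (unwo_vec l) (unwo_vec u))"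
    by (subst emeasure_distr) (simp_all add: eq)
  also have "\<dots> = (\<Prod>b\<in>Basis. (unwo_vec u - unwo_vec l) \<bullet> b)"
    by (rule emeasure_lborel_box) (auto simp: Basis_vec_def inner_axis unwo_vec_def le)
  also have "\<dots> = (\<Prod>i\<in>UNIV. (unwo_vec u - unwo_vec l) $ i)"
    by (simp only: prod_Basis_cart)
  also have "\<dots> = (\<Prod>i\<in>UNIV. (unwo_vec u - unwo_vec l) $ Rep_wo_index i)"
    by (subst prod.reindex_bij_betw[OF bij_Rep_wo_index]) simp
  also have "\<dots> = (\<Prod>i\<in>UNIV. (u - l) $ i)"
    by (simp add: unwo_vec_def Rep_wo_index_inverse)
  also have "\<dots> = (\<Prod>b\<in>Basis. (u - l) \<bullet> b)"
    by (simp only: prod_Basis_cart)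
  finally show "emeasure (distr lborel borel wo_vec) (box l u) = (\<Prod>b\<in>Basis. (u - l) \<bullet> b)" .
qed simp

text \<open>As \<open>A\<close> lies in a hyperplane transversal to \<open>e\<close>, the only
  candidate for \<open>r\<close> is the parameter \<open>t x\<close> at which the line through
  \<open>x\<close> meets that hyperplane. The existential quantifier thus reduces to a Borel
  condition on \<open>x\<close>.\<close>

lemma borel_prism:
  fixes n e :: "'a::euclidean_space"
  assumes ne: "n \<bullet> e \<noteq> 0" and A: "A \<in> sets borel" "A \<subseteq> {z. n \<bullet> z = c}"
  shows "{x. \<exists>r. 0 \<le> r \<and> r \<le> (x + r *\<^sub>R e) \<bullet> e + R \<and> x + r *\<^sub>R e \<in> A} \<in> sets borel"
proof -
  have [measurable]: "A \<in> sets borel" by fact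
  define t where "t = (\<lambda>x. (c - n \<bullet> x) / (n \<bullet> e))"
  have [measurable]: "t \<in> borel_measurable borel" unfolding t_def by measurable
  have "r = t x" if "x + r *\<^sub>R e \<in> A" for x r
    using that A(2) ne by (auto simp: t_def inner_add_right field_simps)
  then have "{x. \<exists>r. 0 \<le> r \<and> r \<le> (x + r *\<^sub>R e) \<bullet> e + R \<and> x + r *\<^sub>R e \<in> A}
      = {x. 0 \<le> t x \<and> t x \<le> (x + t x *\<^sub>R e) \<bullet> e + R \<and> x + t x *\<^sub>R e \<in> A}"
    by blast
  also have "\<dots> \<in> sets borel" by measurable
  finally show ?thesis .
qed

text \<open>This carries the prism formula over to an arbitrary finite index type, since the
  relabelling preserves inner products and volumes. Here \<open>Q\<close> is described from its own
  points and \<open>r\<close> is the parameter length up to the base point, whereas in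
  \<open>prism_volume_wellorder\<close> it was a fraction in [0,1]; the positive height of the prism
  converts one into the other.\<close>

lemma prism_volume:
  fixes n e :: "real^'d"
  assumes n: "norm n = 1" and ne: "n \<bullet> e \<noteq> 0"
    and A: "A \<in> sets borel" "bounded A" "A \<subseteq> {z. n \<bullet> z = c}"
    and pos: "\<And>z. z \<in> A \<Longrightarrow> 0 < z \<bullet> e + R"
  defines "S \<equiv> {x. x - (n \<bullet> x - c) *\<^sub>R n \<in> A \<and> \<bar>n \<bullet> x - c\<bar> \<le> 1/2}"
    and "Q \<equiv> {x. \<exists>r. 0 \<le> r \<and> r \<le> (x + r *\<^sub>R e) \<bullet> e + R \<and> x + r *\<^sub>R e \<in> A}"
  shows "measure lborel Q =
      \<bar>n \<bullet> e\<bar> * (LINT x|lborel. indicator S x * ((x - (n \<bullet> x - c) *\<^sub>R n) \<bullet> e + R))"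
proof -
  define A' where "A' = wo_vec ` A"
  define S' where "S' = {x. x - (wo_vec n \<bullet> x - c) *\<^sub>R wo_vec n \<in> A' \<and> \<bar>wo_vec n \<bullet> x - c\<bar> \<le> 1/2}"
  define Q' where "Q' = {z - (r * (z \<bullet> wo_vec e + R)) *\<^sub>R wo_vec e | z r. z \<in> A' \<and> 0 \<le> r \<and> r \<le> 1}"
  have inj: "wo_vec x = wo_vec y \<longleftrightarrow> x = y" for x y :: "real^'d"
    by (metis unwo_vec_wo_vec)
  have mem: "wo_vec x \<in> A' \<longleftrightarrow> x \<in> A" for x
    by (auto simp: A'_def inj)
  have A'_eq: "A' = unwo_vec -` A"
    using mem by (metis (no_types, opaque_lifting) set_eqI vimageI2 vimageE wo_vec_unwo_vec)
  have A'b: "A' \<in> sets borel"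
    unfolding A'_eq using measurable_sets[OF borel_measurable_unwo_vec A(1)] by simp
  have A'bd: "bounded A'"
    unfolding A'_def using A(2) linear_wo_vec
    by (intro bounded_linear_image) (simp_all add: linear_conv_bounded_linear)
  have n': "norm (wo_vec n) = 1" using n by (simp add: norm_eq_sqrt_inner)
  have Q_eq: "wo_vec x \<in> Q' \<longleftrightarrow> x \<in> Q" for x
  proof
    assume "wo_vec x \<in> Q'"
    then obtain a r where a: "a \<in> A" "0 \<le> r" "r \<le> 1"
      and eq: "wo_vec x = wo_vec a - (r * (wo_vec a \<bullet> wo_vec e + R)) *\<^sub>R wo_vec e"
      by (auto simp: Q'_def A'_def)
    have "wo_vec x = wo_vec (a - (r * (a \<bullet> e + R)) *\<^sub>R e)"
      using eq by (simp add: linear_diff[OF linear_wo_vec] linear_scale[OF linear_wo_vec])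
    then have x: "x + (r * (a \<bullet> e + R)) *\<^sub>R e = a" by (simp add: inj)
    have "0 \<le> r * (a \<bullet> e + R)" "r * (a \<bullet> e + R) \<le> 1 * (a \<bullet> e + R)"
      using a pos[OF a(1)] by (simp_all add: mult_le_cancel_right)
    then show "x \<in> Q"
      unfolding Q_def using a(1) x by (intro CollectI exI[of _ "r * (a \<bullet> e + R)"]) simp
  next
    assume "x \<in> Q"
    then obtain r where r: "0 \<le> r" "r \<le> (x + r *\<^sub>R e) \<bullet> e + R" "x + r *\<^sub>R e \<in> A"
      by (auto simp: Q_def)
    define h where "h = (x + r *\<^sub>R e) \<bullet> e + R"
    have h: "0 < h" using pos[OF r(3)] by (simp add: h_def)
    have "wo_vec x = wo_vec (x + r *\<^sub>R e) - (r / h * (wo_vec (x + r *\<^sub>R e) \<bullet> wo_vec e + R)) *\<^sub>R wo_vec e"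
      unfolding inner_wo_vec h_def[symmetric] using h
      by (simp add: linear_add[OF linear_wo_vec] linear_scale[OF linear_wo_vec])
    moreover have "0 \<le> r / h" "r / h \<le> 1" using h r by (simp_all add: h_def)
    ultimately show "wo_vec x \<in> Q'"
      unfolding Q'_def using r(3) mem by blast
  qed
  have S_eq: "wo_vec x \<in> S' \<longleftrightarrow> x \<in> S" for x
  proof -
    have "wo_vec x - (n \<bullet> x - c) *\<^sub>R wo_vec n = wo_vec (x - (n \<bullet> x - c) *\<^sub>R n)"
      by (simp add: linear_diff[OF linear_wo_vec] linear_scale[OF linear_wo_vec])
    then show ?thesis by (simp add: S'_def S_def mem)
  qed
  have Qb: "Q \<in> sets borel" unfolding Q_def by (rule borel_prism[OF ne A(1,3)])
  have "Q' = unwo_vec -` Q"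
    using Q_eq by (metis (no_types, opaque_lifting) set_eqI vimageI2 vimageE wo_vec_unwo_vec)
  then have Q'b: "Q' \<in> sets borel"
    using measurable_sets[OF borel_measurable_unwo_vec Qb] by simp
  have S'b: "S' \<in> sets borel" unfolding S'_def by (rule borel_orthogonal_slab[OF A'b])
  have "measure lborel Q = measure (distr lborel borel wo_vec) Q'"
    using Q_eq by (subst measure_distr) (auto simp: Q'b vimage_def)
  also have "\<dots> = measure lebesgue Q'" by (simp add: lborel_distr_wo_vec Q'b)
  also have "\<dots> = \<bar>wo_vec n \<bullet> wo_vec e\<bar> *
      (LINT x|lborel. indicator S' x * ((x - (wo_vec n \<bullet> x - c) *\<^sub>R wo_vec n) \<bullet> wo_vec e + R))"
    unfolding Q'_def S'_def
    by (rule prism_volume_wellorder(2)[OF n' _ A'b A'bd]) (use ne A(3) pos in \<open>auto simp: A'_def\<close>)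
  also have "\<dots> = \<bar>n \<bullet> e\<bar> * (LINT x|distr lborel borel wo_vec.
      indicator S' x * ((x - (wo_vec n \<bullet> x - c) *\<^sub>R wo_vec n) \<bullet> wo_vec e + R))"
    by (simp only: lborel_distr_wo_vec inner_wo_vec)
  also have "\<dots> = \<bar>n \<bullet> e\<bar> * (LINT x|lborel.
      indicator S' (wo_vec x) * ((wo_vec x - (wo_vec n \<bullet> wo_vec x - c) *\<^sub>R wo_vec n) \<bullet> wo_vec e + R))"
    using S'b by (subst integral_distr) (simp_all, measurable)
  also have "\<dots> = \<bar>n \<bullet> e\<bar> * (LINT x|lborel. indicator S x * ((x - (n \<bullet> x - c) *\<^sub>R n) \<bullet> e + R))"
    by (simp add: indicator_def S_eq inner_diff_left)
  finally show ?thesis .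
qed

section \<open>Flat faces\<close>

lemma closest_point_hyperplane:
  fixes n :: "'a::euclidean_space"
  assumes "norm n = 1"
  shows "closest_point {z. n \<bullet> z = c} x = x - (n \<bullet> x - c) *\<^sub>R n"
proof (rule closest_point_unique[symmetric])
  have nn: "n \<bullet> n = 1" using assms by (simp add: norm_eq_1)
  show "x - (n \<bullet> x - c) *\<^sub>R n \<in> {z. n \<bullet> z = c}"
    by (simp add: inner_simps nn)
  show "\<forall>z\<in>{z. n \<bullet> z = c}. dist x (x - (n \<bullet> x - c) *\<^sub>R n) \<le> dist x z"
  proof
    fix z assume "z \<in> {z. n \<bullet> z = c}"
    then have "n \<bullet> x - c = n \<bullet> (x - z)" by (simp add: inner_diff_right)
    also have "\<bar>\<dots>\<bar> \<le> norm n * norm (x - z)" by (rule Cauchy_Schwarz_ineq2)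
    finally show "dist x (x - (n \<bullet> x - c) *\<^sub>R n) \<le> dist x z"
      using assms by (simp add: dist_norm)
  qed
qed (simp_all add: convex_hyperplane closed_hyperplane)

lemma infdist_hyperplane:
  fixes n :: "'a::euclidean_space"
  assumes "norm n = 1"
  shows "infdist x {z. n \<bullet> z = c} = \<bar>n \<bullet> x - c\<bar>"
proof -
  have "c *\<^sub>R n \<in> {z. n \<bullet> z = c}" using assms by (simp add: norm_eq_1)
  then have "infdist x {z. n \<bullet> z = c} = dist x (closest_point {z. n \<bullet> z = c} x)"
    unfolding infdist_eq_setdist by (intro setdist_closest_point closed_hyperplane) blast
  then show ?thesis using assms by (simp add: closest_point_hyperplane dist_norm)
qed

lemma affine_hull_eq_hyperplane:
  fixes n :: "'a::euclidean_space"
  assumes "n \<noteq> 0" "S \<subseteq> {z. n \<bullet> z = c}" "aff_dim S = int DIM('a) - 1"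
  shows "affine hull S = {z. n \<bullet> z = c}"
proof -
  have "S \<noteq> {}"
    using assms(3) DIM_positive[where 'a='a] by auto
  show ?thesis
  proof (rule affine_dim_equal)
    show "affine hull S \<noteq> {}" using \<open>S \<noteq> {}\<close> by simp
    show "affine hull S \<subseteq> {z. n \<bullet> z = c}"
      by (rule hull_minimal) (use assms(2) affine_hyperplane in auto)
    show "aff_dim (affine hull S) = aff_dim {z. n \<bullet> z = c}"
      using assms by (simp add: aff_dim_hyperplane)
  qed (simp_all add: affine_hyperplane)
qed

text \<open>By definition, integrals over a face are volume integrals over this slab.\<close>

definition unit_slab :: "'a::euclidean_space \<Rightarrow> real \<Rightarrow> 'a set \<Rightarrow> 'a set" where
  "unit_slab n c A = {x. x - (n \<bullet> x - c) *\<^sub>R n \<in> A \<and> \<bar>n \<bullet> x - c\<bar> \<le> 1/2}"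

lemma integral_hyperplane_measure:
  fixes n :: "'a::euclidean_space" and g :: "'a \<Rightarrow> 'b::{banach, second_countable_topology}"
  assumes n: "norm n = 1" and A: "A \<in> sets borel" and g: "g \<in> borel_measurable borel"
  shows "(LINT x:A|hyperplane_measure {z. n \<bullet> z = c}. g x)
    = (LINT x|lborel. indicator (unit_slab n c A) x *\<^sub>R g (x - (n \<bullet> x - c) *\<^sub>R n))"
proof -
  note [measurable] = A g
  have T: "{x. infdist x {z. n \<bullet> z = c} \<le> 1/2} = {x. \<bar>n \<bullet> x - c\<bar> \<le> 1/2}"
    by (simp add: infdist_hyperplane[OF n])
  have P: "closest_point {z. n \<bullet> z = c} = (\<lambda>x. x - (n \<bullet> x - c) *\<^sub>R n)"
    by (rule ext) (rule closest_point_hyperplane[OF n])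
  have [measurable]: "{x. \<bar>n \<bullet> x - c\<bar> \<le> 1/2} \<in> sets borel" by measurable
  have "(LINT x:A|hyperplane_measure {z. n \<bullet> z = c}. g x)
      = (LINT x|restrict_space lborel {x. \<bar>n \<bullet> x - c\<bar> \<le> 1/2}.
          indicator A (x - (n \<bullet> x - c) *\<^sub>R n) *\<^sub>R g (x - (n \<bullet> x - c) *\<^sub>R n))"
    unfolding set_lebesgue_integral_def hyperplane_measure_def T P
    by (rule integral_distr) (auto intro!: measurable_restrict_space1)
  also have "\<dots> = (LINT x|lborel. indicator {x. \<bar>n \<bullet> x - c\<bar> \<le> 1/2} x *\<^sub>R
          (indicator A (x - (n \<bullet> x - c) *\<^sub>R n) *\<^sub>R g (x - (n \<bullet> x - c) *\<^sub>R n)))"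
    by (rule integral_restrict_space) simp
  also have "\<dots> = (LINT x|lborel. indicator (unit_slab n c A) x *\<^sub>R g (x - (n \<bullet> x - c) *\<^sub>R n))"
    by (intro Bochner_Integration.integral_cong) (auto simp: unit_slab_def indicator_def)
  finally show ?thesis .
qed

text \<open>The normal is a parameter, not \<open>normal K \<sigma>\<close>, so that these facts
  apply to any candidate normal before its uniqueness is known.\<close>

locale flat_face =
  fixes \<sigma> :: "'a::euclidean_space set" and n :: 'a and c :: real
  assumes n: "norm n = 1"
    and subset: "\<sigma> \<subseteq> {z. n \<bullet> z = c}"
    and aff_dim: "aff_dim \<sigma> = int DIM('a) - 1"
    and polytopal: "polytopal \<sigma>"
begin

lemma hull: "affine hull \<sigma> = {z. n \<bullet> z = c}"
proof -
  have "n \<noteq> 0" using n by auto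
  then show ?thesis by (rule affine_hull_eq_hyperplane[OF _ subset aff_dim])
qed

lemma nonempty: "\<sigma> \<noteq> {}"
  using aff_dim DIM_positive[where 'a='a] by auto

lemma bounded: "bounded \<sigma>"
  using polytopal by (simp add: polytopal_def)

lemma openin: "openin (top_of_set {z. n \<bullet> z = c}) \<sigma>"
  using polytopal by (simp add: polytopal_def hull)

lemma open_extension: obtains U where "open U" "\<sigma> = {z. n \<bullet> z = c} \<inter> U"
  using openin by (auto simp: openin_open)

lemma borel: "\<sigma> \<in> sets borel"
  by (rule open_extension) (auto intro!: borel_closed closed_hyperplane)

lemma closure_subset: "closure \<sigma> \<subseteq> {z. n \<bullet> z = c}"
  by (rule closure_minimal[OF subset closed_hyperplane])

lemma unit_slab_borel: "unit_slab n c \<sigma> \<in> sets borel"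
  unfolding unit_slab_def by (rule borel_orthogonal_slab[OF borel])

lemma unit_slab_bounded: "bounded (unit_slab n c \<sigma>)"
  unfolding unit_slab_def by (rule bounded_orthogonal_slab[OF bounded])

text \<open>A relatively open face is cut out of its hyperplane by an open set, whose preimage under
  the continuous orthogonal projection is this cylinder. Its openness yields both the positivity of
  the area and the existence of generic points of the face.\<close>

lemma open_cylinder: "open {x. x - (n \<bullet> x - c) *\<^sub>R n \<in> \<sigma>}"
proof (rule open_extension)
  fix U assume U: "open U" "\<sigma> = {z. n \<bullet> z = c} \<inter> U"
  have "n \<bullet> (x - (n \<bullet> x - c) *\<^sub>R n) = c" for x
    using n by (simp add: inner_simps norm_eq_1)
  then have "{x. x - (n \<bullet> x - c) *\<^sub>R n \<in> \<sigma>} = (\<lambda>x. x - (n \<bullet> x - c) *\<^sub>R n) -` U"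
    by (auto simp: U)
  also have "open \<dots>"
    by (intro open_vimage U continuous_intros)
  finally show ?thesis .
qed

lemma face_area_eq: "face_area \<sigma> = measure lborel (unit_slab n c \<sigma>)"
proof -
  have "space (hyperplane_measure {z. n \<bullet> z = c}) = UNIV"
    "sets (hyperplane_measure {z. n \<bullet> z = c}) = sets borel"
    by (simp_all add: hyperplane_measure_def)
  then have "face_area \<sigma> = (LINT x:\<sigma>|hyperplane_measure {z. n \<bullet> z = c}. (1::real))"
    by (simp add: face_area_def hull set_lebesgue_integral_def borel)
  also have "\<dots> = measure lborel (unit_slab n c \<sigma>)"
    using unit_slab_borel by (subst integral_hyperplane_measure[OF n borel]) simp_all
  finally show ?thesis .
qed

text \<open>The slab over the face contains a non-empty open set, and such a set is not
  negligible.\<close>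

lemma face_area_pos: "0 < face_area \<sigma>"
proof -
  obtain z where z: "z \<in> \<sigma>" using nonempty by auto
  let ?U = "{x. x - (n \<bullet> x - c) *\<^sub>R n \<in> \<sigma>} \<inter> {x. \<bar>n \<bullet> x - c\<bar> < 1/2}"
  have "open ?U"
    by (intro open_Int open_cylinder open_Collect_less continuous_intros)
  moreover have "z \<in> ?U" using z subset by auto
  ultimately have "\<not> negligible ?U" using open_not_negligible by blast
  moreover have "?U \<subseteq> unit_slab n c \<sigma>" by (auto simp: unit_slab_def)
  ultimately have nn: "\<not> negligible (unit_slab n c \<sigma>)" using negligible_subset by blast
  have m: "unit_slab n c \<sigma> \<in> lmeasurable"
    using unit_slab_borel unit_slab_bounded by (intro bounded_set_imp_lmeasurable) auto
  have "measure lebesgue (unit_slab n c \<sigma>) \<noteq> 0"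
    using nn negligible_iff_measure[of "unit_slab n c \<sigma>"] m by blast
  then show ?thesis
    using unit_slab_borel by (simp add: face_area_eq less_le)
qed

lemma face_center_integral:
  "(LINT x|lborel. indicator (unit_slab n c \<sigma>) x *\<^sub>R (x - (n \<bullet> x - c) *\<^sub>R n))
    = face_area \<sigma> *\<^sub>R face_center \<sigma>"
  using face_area_pos integral_hyperplane_measure[OF n borel, of "\<lambda>x. x" c]
  by (simp add: face_center_def hull)

text \<open>The mean of an affine function over a face is its value at the center of gravity,
  because a linear functional commutes with the integral.\<close>

lemma integral_affine_height:
  "(LINT x|lborel. indicator (unit_slab n c \<sigma>) x * ((x - (n \<bullet> x - c) *\<^sub>R n) \<bullet> e + R))
    = face_area \<sigma> * (face_center \<sigma> \<bullet> e + R)"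
proof -
  let ?S = "unit_slab n c \<sigma>" and ?P = "\<lambda>x. x - (n \<bullet> x - c) *\<^sub>R n"
  have "set_integrable lborel ?S ?P"
    by (intro set_integrable_continuous_bounded unit_slab_borel unit_slab_bounded continuous_intros)
  then have i1: "integrable lborel (\<lambda>x. indicator ?S x *\<^sub>R ?P x)"
    by (simp add: set_integrable_def)
  have "set_integrable lborel ?S (\<lambda>x. R)"
    by (intro set_integrable_continuous_bounded unit_slab_borel unit_slab_bounded continuous_intros)
  then have i2: "integrable lborel (\<lambda>x. indicator ?S x * R)"
    by (simp add: set_integrable_def)
  have "(LINT x|lborel. indicator ?S x * (?P x \<bullet> e + R))
      = (LINT x|lborel. (indicator ?S x *\<^sub>R ?P x) \<bullet> e + indicator ?S x * R)"
    by (simp add: distrib_left)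
  also have "\<dots> = (LINT x|lborel. (indicator ?S x *\<^sub>R ?P x) \<bullet> e) + (LINT x|lborel. indicator ?S x * R)"
    by (rule Bochner_Integration.integral_add[OF integrable_inner_left[OF i1] i2])
  also have "\<dots> = (face_area \<sigma> *\<^sub>R face_center \<sigma>) \<bullet> e + measure lborel ?S * R"
    using i1 unit_slab_borel by (subst integral_inner_left) (simp_all add: face_center_integral)
  finally show ?thesis by (simp add: face_area_eq distrib_left)
qed

end

section \<open>Generic lines in a fixed direction\<close>

text \<open>Adjoining the direction \<open>e\<close> raises the dimension of \<open>A\<close> by at
  most one, so all lines parallel to \<open>e\<close> through \<open>A\<close> stay in one
  hyperplane.\<close>

lemma negligible_line_cylinder:
  fixes A :: "'a::euclidean_space set"
  assumes A: "affine A" "aff_dim A < int DIM('a) - 1"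
  shows "negligible {x. \<exists>t. x + t *\<^sub>R e \<in> A}"
proof (cases "A = {}")
  case False
  then obtain a where a: "a \<in> A" by auto
  have "aff_dim (insert (a + e) A) < int DIM('a)"
    using A by (simp add: aff_dim_insert)
  then obtain m b where mb: "m \<noteq> 0" "insert (a + e) A \<subseteq> {x. m \<bullet> x = b}"
    by (rule aff_lowdim_subset_hyperplane)
  have "m \<bullet> e = 0" using mb(2) a by (auto simp: inner_add_right)
  then have "{x. \<exists>t. x + t *\<^sub>R e \<in> A} \<subseteq> {x. m \<bullet> x = b}"
    using mb(2) by (auto simp: inner_add_right)
  then show ?thesis
    using mb(1) negligible_hyperplane negligible_subset by blast
qed simp

text \<open>Three kinds of base points are discarded: those in a face hyperplane parallel to
  \<open>e\<close> (\<open>N1\<close>), those whose line meets the relative boundary of a face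
  (\<open>N2\<close>), and those whose line meets the intersection of two distinct face hyperplanes
  (\<open>N3\<close>). The sets met in the last two cases have codimension at least two, so their
  cylinders are negligible.\<close>

lemma exceptional_lines:
  fixes E :: "'a::euclidean_space set set" and e :: 'a
  assumes fin: "finite E" and disj: "disjoint E"
    and face: "\<And>\<sigma>. \<sigma> \<in> E \<Longrightarrow> flat_face \<sigma> (\<nu> \<sigma>) (c \<sigma>)"
  obtains N where "negligible N"
    "\<And>x t \<sigma>. x \<notin> N \<Longrightarrow> \<sigma> \<in> E \<Longrightarrow> x + t *\<^sub>R e \<in> closure \<sigma> \<Longrightarrow>
      \<nu> \<sigma> \<bullet> e \<noteq> 0 \<and> x + t *\<^sub>R e \<in> \<sigma> \<and> (\<forall>\<sigma>'\<in>E. \<sigma>' \<noteq> \<sigma> \<longrightarrow> x + t *\<^sub>R e \<notin> closure \<sigma>')"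
proof -
  define H where "H = (\<lambda>\<sigma>. {z. \<nu> \<sigma> \<bullet> z = c \<sigma>})"
  define cyl where "cyl = (\<lambda>A. {x. \<exists>t. x + t *\<^sub>R e \<in> A})"
  \<comment> \<open>A face is relatively open, so its relative boundary is
    \<open>closure \<sigma> - \<sigma>\<close>; polytopality covers it by affine sets of codimension
    at least two.\<close>
  have polyt: "\<exists>\<A>. finite \<A> \<and> (\<forall>A\<in>\<A>. affine A \<and> aff_dim A < int DIM('a) - 1) \<and> closure \<sigma> - \<sigma> \<subseteq> \<Union>\<A>"
    if "\<sigma> \<in> E" for \<sigma>
  proof -
    interpret flat_face \<sigma> "\<nu> \<sigma>" "c \<sigma>" by (rule face[OF that])
    have "rel_frontier \<sigma> = closure \<sigma> - \<sigma>"
      using polytopal by (simp add: rel_frontier_def rel_interior_openin polytopal_def)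
    then show ?thesis using polytopal by (simp add: polytopal_def aff_dim)
  qed
  then obtain \<A> where \<A>: "\<And>\<sigma>. \<sigma> \<in> E \<Longrightarrow> finite (\<A> \<sigma>)"
    "\<And>\<sigma> A. \<sigma> \<in> E \<Longrightarrow> A \<in> \<A> \<sigma> \<Longrightarrow> affine A \<and> aff_dim A < int DIM('a) - 1"
    "\<And>\<sigma>. \<sigma> \<in> E \<Longrightarrow> closure \<sigma> - \<sigma> \<subseteq> \<Union>(\<A> \<sigma>)"
    by metis
  define N1 where "N1 = (\<Union>\<sigma>\<in>E. if \<nu> \<sigma> \<bullet> e = 0 then H \<sigma> else {})"
  define N2 where "N2 = (\<Union>\<sigma>\<in>E. \<Union>A\<in>\<A> \<sigma>. cyl A)"
  define N3 where "N3 = (\<Union>\<sigma>\<in>E. \<Union>\<sigma>'\<in>E. if H \<sigma> = H \<sigma>' then {} else cyl (H \<sigma> \<inter> H \<sigma>'))"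
  have cylN: "negligible (cyl A)" if "affine A" "aff_dim A < int DIM('a) - 1" for A
    unfolding cyl_def by (rule negligible_line_cylinder[OF that])
  have "negligible N1"
    unfolding N1_def
  proof (rule negligible_Union)
    fix T assume "T \<in> (\<lambda>\<sigma>. if \<nu> \<sigma> \<bullet> e = 0 then H \<sigma> else {}) ` E"
    then obtain \<sigma> where \<sigma>: "\<sigma> \<in> E" "T = H \<sigma> \<or> T = {}" by auto
    have "\<nu> \<sigma> \<noteq> 0" using flat_face.n[OF face[OF \<sigma>(1)]] by auto
    then show "negligible T" using \<sigma>(2) negligible_hyperplane by (auto simp: H_def)
  qed (use fin in simp)
  moreover have "negligible N2"
    unfolding N2_def
    by (intro negligible_Union finite_imageI fin) (auto intro!: negligible_Union cylN dest: \<A>)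
  moreover have "negligible N3"
    unfolding N3_def
  proof (intro negligible_Union finite_imageI fin; clarify)
    fix \<sigma> assume s: "\<sigma> \<in> E"
    show "negligible (\<Union>\<sigma>'\<in>E. if H \<sigma> = H \<sigma>' then {} else cyl (H \<sigma> \<inter> H \<sigma>'))"
    proof (intro negligible_Union finite_imageI fin; clarify)
      fix \<sigma>' assume s': "\<sigma>' \<in> E"
      show "negligible (if H \<sigma> = H \<sigma>' then {} else cyl (H \<sigma> \<inter> H \<sigma>'))"
      proof (cases "H \<sigma> = H \<sigma>'")
        case False
        have nz: "\<nu> \<sigma> \<noteq> 0" "\<nu> \<sigma>' \<noteq> 0"
          using flat_face.n[OF face[OF s]] flat_face.n[OF face[OF s']] by auto
        have aff: "affine (H \<sigma>)" "affine (H \<sigma>')" by (simp_all add: H_def affine_hyperplane)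
        have ne: "H \<sigma> \<noteq> {}"
          using flat_face.nonempty[OF face[OF s]] flat_face.subset[OF face[OF s]] by (auto simp: H_def)
        have dim: "aff_dim (H \<sigma>) = int DIM('a) - 1" "aff_dim (H \<sigma>') = int DIM('a) - 1"
          using nz by (simp_all add: H_def aff_dim_hyperplane)
        have "\<not> H \<sigma> \<subseteq> H \<sigma>'"
          using affine_dim_equal[OF aff ne] dim False by auto
        then have "H \<sigma> \<inter> H \<sigma>' \<subset> H \<sigma>" by auto
        then have "aff_dim (H \<sigma> \<inter> H \<sigma>') < aff_dim (H \<sigma>)"
          using aff by (intro aff_dim_psubset) (simp add: affine_Int hull_same)
        then have "negligible (cyl (H \<sigma> \<inter> H \<sigma>'))"
          using aff dim by (intro cylN affine_Int) auto
        then show ?thesis using False by simp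
      qed simp
    qed
  qed
  ultimately have neg: "negligible (N1 \<union> N2 \<union> N3)" by simp
  show thesis
  proof (rule that[OF neg], intro conjI ballI impI)
    fix x t \<sigma> assume x: "x \<notin> N1 \<union> N2 \<union> N3" and s: "\<sigma> \<in> E" and cl: "x + t *\<^sub>R e \<in> closure \<sigma>"
    have inH: "x + t *\<^sub>R e \<in> H \<sigma>"
      using flat_face.closure_subset[OF face[OF s]] cl by (auto simp: H_def)
    show "\<nu> \<sigma> \<bullet> e \<noteq> 0"
    proof
      assume 0: "\<nu> \<sigma> \<bullet> e = 0"
      then have "x \<in> H \<sigma>" using inH by (simp add: H_def inner_add_right)
      then have "x \<in> N1" using s 0 unfolding N1_def by auto
      then show False using x by simp
    qed
    show mem: "x + t *\<^sub>R e \<in> \<sigma>"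
    proof (rule ccontr)
      assume "x + t *\<^sub>R e \<notin> \<sigma>"
      then obtain A where "A \<in> \<A> \<sigma>" "x + t *\<^sub>R e \<in> A" using \<A>(3)[OF s] cl by auto
      then have "x \<in> N2" using s unfolding N2_def cyl_def by blast
      then show False using x by simp
    qed
    fix \<sigma>' assume s': "\<sigma>' \<in> E" and ne: "\<sigma>' \<noteq> \<sigma>"
    show "x + t *\<^sub>R e \<notin> closure \<sigma>'"
    proof
      assume cl': "x + t *\<^sub>R e \<in> closure \<sigma>'"
      then have inH': "x + t *\<^sub>R e \<in> H \<sigma>'"
        using flat_face.closure_subset[OF face[OF s']] by (auto simp: H_def)
      have "H \<sigma> = H \<sigma>'"
      proof (rule ccontr)
        assume "H \<sigma> \<noteq> H \<sigma>'"
        then have "x \<in> N3" using inH inH' s s' unfolding N3_def cyl_def by auto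
        then show False using x by simp
      qed
      \<comment> \<open>Within the common hyperplane \<open>\<sigma>\<close> is relatively open, so
        a point of \<open>\<sigma>\<close> in the closure of \<open>\<sigma>'\<close> would make the
        two faces intersect.\<close>
      obtain U where U: "open U" "\<sigma> = H \<sigma> \<inter> U"
        using flat_face.open_extension[OF face[OF s]] by (metis H_def)
      have "U \<inter> \<sigma>' \<noteq> {}"
        using open_Int_closure_eq_empty[OF U(1), of \<sigma>'] cl' mem U(2) by auto
      moreover have "\<sigma>' \<subseteq> H \<sigma>"
        using flat_face.subset[OF face[OF s']] \<open>H \<sigma> = H \<sigma>'\<close> by (simp add: H_def)
      ultimately have "\<sigma> \<inter> \<sigma>' \<noteq> {}" using U(2) by auto
      then show False using disj s s' ne by (auto simp: disjoint_def)
    qed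
  qed
qed

section \<open>Cells\<close>

text \<open>Moving from \<open>z\<close> by a small multiple of \<open>n - m\<close> decreases the
  \<open>m\<close>-component and increases the \<open>n\<close>-component. If the normals differed,
  the point reached would lie in \<open>K\<close> according to \<open>m\<close> and outside it
  according to \<open>n\<close>.\<close>

lemma outward_unit_normal_unique:
  assumes m: "is_outward_unit_normal K \<sigma> m" and n: "is_outward_unit_normal K \<sigma> n"
    and z: "z \<in> \<sigma>" "0 < \<epsilon>" "ball z \<epsilon> \<inter> frontier K \<subseteq> \<sigma>"
  shows "m = n"
proof (rule ccontr)
  assume "m \<noteq> n"
  obtain \<epsilon>1 where e1: "0 < \<epsilon>1" "ball z \<epsilon>1 \<inter> K = {y \<in> ball z \<epsilon>1. m \<bullet> (y - z) < 0}"
    using m z unfolding is_outward_unit_normal_def by blast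
  obtain \<epsilon>2 where e2: "0 < \<epsilon>2" "ball z \<epsilon>2 \<inter> K = {y \<in> ball z \<epsilon>2. n \<bullet> (y - z) < 0}"
    using n z unfolding is_outward_unit_normal_def by blast
  have nrm: "norm m = 1" "norm n = 1" using m n by (auto simp: is_outward_unit_normal_def)
  then have nn: "m \<bullet> m = 1" "n \<bullet> n = 1" by (simp_all add: norm_eq_1)
  have "m \<bullet> n < 1"
  proof -
    have "0 < (m - n) \<bullet> (m - n)" using \<open>m \<noteq> n\<close> by simp
    then show ?thesis by (simp add: inner_simps nn inner_commute)
  qed
  \<comment> \<open>The displacement \<open>n - m\<close> has norm at most 2, so the factor 1/4
    keeps \<open>y\<close> within half of either radius.\<close>
  define \<delta> where "\<delta> = min \<epsilon>1 \<epsilon>2 / 4"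
  have d: "0 < \<delta>" using e1 e2 by (simp add: \<delta>_def)
  define y where "y = z + \<delta> *\<^sub>R (n - m)"
  have "norm (n - m) \<le> 2" using norm_triangle_ineq4[of n m] nrm by simp
  then have "dist z y \<le> \<delta> * 2" using d by (simp add: y_def dist_norm)
  then have "y \<in> ball z \<epsilon>1" "y \<in> ball z \<epsilon>2" using e1(1) e2(1) by (auto simp: \<delta>_def)
  then have "m \<bullet> (y - z) < 0 \<longleftrightarrow> n \<bullet> (y - z) < 0" using e1(2) e2(2) by blast
  moreover have "m \<bullet> (y - z) = \<delta> * (m \<bullet> n - 1)" "n \<bullet> (y - z) = \<delta> * (1 - m \<bullet> n)"
    by (simp_all add: y_def inner_simps nn inner_commute)
  ultimately show False using d \<open>m \<bullet> n < 1\<close> by (simp add: mult_less_0_iff)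
qed

locale polytopal_cell =
  fixes K :: "(real^'d) set" and E :: "(real^'d) set set"
  assumes openK: "open K" and boundedK: "bounded K"
    and finE: "finite E" and disjE: "disjoint E"
    and faces_frontier: "\<Union>E \<subseteq> frontier K"
    and frontier_faces: "frontier K \<subseteq> (\<Union>\<sigma>\<in>E. closure \<sigma>)"
    and face: "\<And>\<sigma>. \<sigma> \<in> E \<Longrightarrow> polytopal \<sigma> \<and> aff_dim \<sigma> = int CARD('d) - 1 \<and>
      (\<exists>n. is_outward_unit_normal K \<sigma> n)"
begin

lemma flat_face_if_outward:
  assumes "\<sigma> \<in> E" "is_outward_unit_normal K \<sigma> n"
  shows "\<exists>c. flat_face \<sigma> n c"
  using assms face[OF assms(1)] by (auto simp: is_outward_unit_normal_def flat_face_def)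

text \<open>The closures of the other faces form a closed set that misses \<open>z\<close>, so the
  boundary of \<open>K\<close> near \<open>z\<close> lies in the closure of \<open>\<sigma>\<close>.
  Relative openness of \<open>\<sigma>\<close> then places it in \<open>\<sigma>\<close>
  itself.\<close>

lemma isolated_face_point:
  assumes s: "\<sigma> \<in> E" "flat_face \<sigma> n c" and z: "z \<in> \<sigma>"
    and iso: "\<And>\<sigma>'. \<sigma>' \<in> E \<Longrightarrow> \<sigma>' \<noteq> \<sigma> \<Longrightarrow> z \<notin> closure \<sigma>'"
  shows "\<exists>\<epsilon>>0. ball z \<epsilon> \<inter> frontier K \<subseteq> \<sigma>"
proof -
  interpret flat_face \<sigma> n c by fact
  obtain U where U: "open U" "\<sigma> = {z. n \<bullet> z = c} \<inter> U" by (rule open_extension)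
  let ?C = "\<Union>\<sigma>'\<in>E - {\<sigma>}. closure \<sigma>'"
  have "open (U - ?C)"
    using finE by (intro open_Diff U closed_UN) auto
  moreover have "z \<in> U - ?C" using z iso U by auto
  ultimately obtain \<epsilon> where e: "0 < \<epsilon>" "ball z \<epsilon> \<subseteq> U - ?C"
    by (meson openE)
  have "ball z \<epsilon> \<inter> frontier K \<subseteq> \<sigma>"
  proof
    fix y assume y: "y \<in> ball z \<epsilon> \<inter> frontier K"
    then have "y \<in> closure \<sigma>" using frontier_faces e(2) by blast
    then show "y \<in> \<sigma>" using closure_subset y e(2) U(2) by blast
  qed
  then show ?thesis using e(1) by blast
qed

text \<open>\<open>normal\<close> is a definite description, so uniqueness has to be established at
  some point of \<open>\<sigma>\<close> near which the boundary is \<open>\<sigma>\<close> alone.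
  Such a point is the foot of a generic line in the direction of a candidate normal
  \<open>n\<close>: the open cylinder over \<open>\<sigma>\<close> cannot be contained in the
  negligible exceptional set.\<close>

lemma outward_normal:
  assumes s: "\<sigma> \<in> E"
  shows "is_outward_unit_normal K \<sigma> (normal K \<sigma>)"
proof -
  obtain n where n: "is_outward_unit_normal K \<sigma> n" using face[OF s] by auto
  obtain c where "flat_face \<sigma> n c" using flat_face_if_outward[OF s n] by auto
  then interpret f: flat_face \<sigma> n c .
  obtain \<nu> where \<nu>: "\<And>\<sigma>'. \<sigma>' \<in> E \<Longrightarrow> is_outward_unit_normal K \<sigma>' (\<nu> \<sigma>')" using face by metis
  have "\<exists>c. flat_face \<sigma>' (\<nu> \<sigma>') c" if "\<sigma>' \<in> E" for \<sigma>'
    by (rule flat_face_if_outward[OF that \<nu>[OF that]])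
  then obtain c' where "\<And>\<sigma>'. \<sigma>' \<in> E \<Longrightarrow> flat_face \<sigma>' (\<nu> \<sigma>') (c' \<sigma>')"
    by metis
  then obtain N where N: "negligible N" "\<And>x t \<sigma>'. x \<notin> N \<Longrightarrow> \<sigma>' \<in> E \<Longrightarrow> x + t *\<^sub>R n \<in> closure \<sigma>' \<Longrightarrow>
      \<nu> \<sigma>' \<bullet> n \<noteq> 0 \<and> x + t *\<^sub>R n \<in> \<sigma>' \<and> (\<forall>\<sigma>''\<in>E. \<sigma>'' \<noteq> \<sigma>' \<longrightarrow> x + t *\<^sub>R n \<notin> closure \<sigma>'')"
    using exceptional_lines[OF finE disjE, of \<nu> c' n] by metis
  let ?C = "{x. x - (n \<bullet> x - c) *\<^sub>R n \<in> \<sigma>}"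
  obtain z0 where z0: "z0 \<in> \<sigma>" using f.nonempty by blast
  then have "n \<bullet> z0 = c" using f.subset by blast
  then have "z0 \<in> ?C" using z0 by simp
  then have "?C \<noteq> {}" by blast
  then have "\<not> negligible ?C"
    by (rule open_not_negligible[OF f.open_cylinder])
  then have "\<not> ?C \<subseteq> N"
    using negligible_subset[OF N(1)] by blast
  then obtain x where x: "x \<notin> N" "x - (n \<bullet> x - c) *\<^sub>R n \<in> \<sigma>" by auto
  define z where "z = x + (- (n \<bullet> x - c)) *\<^sub>R n"
  have z: "z \<in> \<sigma>" using x(2) unfolding z_def scaleR_minus_left by simp
  then have "z \<in> closure \<sigma>" using closure_subset by auto
  then have "\<forall>\<sigma>'\<in>E. \<sigma>' \<noteq> \<sigma> \<longrightarrow> z \<notin> closure \<sigma>'"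
    unfolding z_def by (intro N(2)[OF x(1) s, THEN conjunct2, THEN conjunct2])
  then have "\<exists>\<epsilon>>0. ball z \<epsilon> \<inter> frontier K \<subseteq> \<sigma>"
    by (intro isolated_face_point[OF s \<open>flat_face \<sigma> n c\<close> z]) simp
  then obtain \<epsilon> where eps: "0 < \<epsilon>" "ball z \<epsilon> \<inter> frontier K \<subseteq> \<sigma>" by blast
  have "m = n" if "is_outward_unit_normal K \<sigma> m" for m
    by (rule outward_unit_normal_unique[OF that n z eps])
  then show ?thesis
    unfolding normal_def by (rule theI[where P="is_outward_unit_normal K \<sigma>", OF n])
qed

lemma flat_face_normal:
  assumes "\<sigma> \<in> E"
  shows "\<exists>c. flat_face \<sigma> (normal K \<sigma>) c"
  by (rule flat_face_if_outward[OF assms outward_normal[OF assms]])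

end

section \<open>The indicator of a cell along a line\<close>

text \<open>Connectedness of the real line: the sets \<open>Z c\<close> are open, pairwise disjoint
  and cover the line, so \<open>Z 0\<close> is clopen, and it is non-empty by the assumption on
  large arguments. Punctured neighbourhoods allow for stray values of \<open>D\<close> at isolated
  points.\<close>

lemma punctured_locally_constant_zero:
  fixes D :: "real \<Rightarrow> real"
  assumes loc: "\<And>t. \<exists>c. \<forall>\<^sub>F s in at t. D s = c"
    and zero: "\<And>s. B < s \<Longrightarrow> D s = 0"
  shows "\<forall>\<^sub>F s in at t. D s = 0"
proof -
  define Z where "Z = (\<lambda>c. {t. \<forall>\<^sub>F s in at t. D s = c})"
  have openZ: "open (Z c)" for c
  proof (subst open_subopen, rule ballI)
    fix t assume "t \<in> Z c"
    then have t: "\<forall>\<^sub>F s in at t. D s = c" by (simp add: Z_def)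
    then obtain U where U: "open U" "t \<in> U" "\<forall>s\<in>U. s \<noteq> t \<longrightarrow> D s = c"
      unfolding eventually_at_topological by auto
    have "U \<subseteq> Z c"
    proof
      fix y assume y: "y \<in> U"
      show "y \<in> Z c"
      proof (cases "y = t")
        case False
        have "open (U - {t})" using U(1) by (rule open_delete)
        moreover have "y \<in> U - {t}" using y False by simp
        moreover have "\<forall>s\<in>U - {t}. s \<noteq> y \<longrightarrow> D s = c" using U(3) by simp
        ultimately show ?thesis
          unfolding Z_def mem_Collect_eq eventually_at_topological by (intro exI[of _ "U - {t}"]) simp
      qed (use t in \<open>simp add: Z_def\<close>)
    qed
    then show "\<exists>T. open T \<and> t \<in> T \<and> T \<subseteq> Z c" using U(1,2) by (intro exI conjI)
  qed
  have "- Z 0 = (\<Union>c\<in>- {0}. Z c)"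
  proof (intro equalityI subsetI)
    fix t assume t: "t \<in> - Z 0"
    obtain c where "\<forall>\<^sub>F s in at t. D s = c" using loc by blast
    then have c: "t \<in> Z c" by (simp add: Z_def)
    then have "c \<noteq> 0" using t by auto
    then show "t \<in> (\<Union>c\<in>- {0}. Z c)" using c by auto
  next
    fix t assume "t \<in> (\<Union>c\<in>- {0}. Z c)"
    then obtain c where c: "c \<noteq> 0" "\<forall>\<^sub>F s in at t. D s = c" by (auto simp: Z_def)
    show "t \<in> - Z 0"
    proof
      assume "t \<in> Z 0"
      then have "\<forall>\<^sub>F s in at t. D s = 0" by (simp add: Z_def)
      with c(2) have "\<forall>\<^sub>F s in at t. False" by eventually_elim (simp add: c(1))
      then show False by simp
    qed
  qed
  then have "open (- Z 0)" using openZ by (simp add: open_UN)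
  then have "Z 0 = {} \<or> Z 0 = UNIV"
    using clopen[of "Z 0"] openZ[of 0] by (simp add: closed_def)
  moreover have "B + 1 \<in> Z 0"
    unfolding Z_def mem_Collect_eq eventually_at_topological
    by (intro exI[of _ "{B<..}"]) (use zero in simp)
  ultimately have "t \<in> Z 0" by auto
  then show ?thesis by (simp add: Z_def)
qed

definition shadow :: "'a::euclidean_space set \<Rightarrow> 'a \<Rightarrow> 'a set" where
  "shadow \<sigma> e = {x. \<exists>r\<ge>0. x + r *\<^sub>R e \<in> \<sigma>}"

lemma open_line_preimage: "open U \<Longrightarrow> open {s. x + s *\<^sub>R e \<in> U}"
  for U :: "'a::real_normed_vector set"
  using open_vimage[of U "\<lambda>s. x + s *\<^sub>R e"] by (simp add: vimage_def continuous_intros)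

context polytopal_cell
begin

text \<open>On a generic line the difference \<open>D\<close> of the two sides is shown to be
  constant on punctured neighbourhoods of every point: away from the boundary nothing changes, and
  at a crossing the jumps of the two sides cancel. It vanishes far out in direction
  \<open>e\<close>, hence near \<open>t = 0\<close>.\<close>

lemma indicator_eq_sum_shadows:
  assumes e: "norm e = 1"
  obtains N where "negligible N"
    "\<And>x. x \<notin> N \<Longrightarrow> indicator K x = (\<Sum>\<sigma>\<in>E. sgn (normal K \<sigma> \<bullet> e) * indicator (shadow \<sigma> e) x)"
proof -
  obtain c where c: "\<And>\<sigma>. \<sigma> \<in> E \<Longrightarrow> flat_face \<sigma> (normal K \<sigma>) (c \<sigma>)"
    using flat_face_normal by metis
  obtain N where N: "negligible N" "\<And>x t \<sigma>. x \<notin> N \<Longrightarrow> \<sigma> \<in> E \<Longrightarrow> x + t *\<^sub>R e \<in> closure \<sigma> \<Longrightarrow>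
      normal K \<sigma> \<bullet> e \<noteq> 0 \<and> x + t *\<^sub>R e \<in> \<sigma> \<and> (\<forall>\<sigma>'\<in>E. \<sigma>' \<noteq> \<sigma> \<longrightarrow> x + t *\<^sub>R e \<notin> closure \<sigma>')"
    using exceptional_lines[OF finE disjE c, of e] by metis
  \<comment> \<open>Discarding the face hyperplanes keeps \<open>x\<close> off the boundary of
    \<open>K\<close>. The parameter 0 is then no crossing, so the value of \<open>D\<close> near 0
    is also its value at 0.\<close>
  define N0 where "N0 = (\<Union>\<sigma>\<in>E. {z. normal K \<sigma> \<bullet> z = c \<sigma>})"
  have "negligible N0"
    unfolding N0_def
  proof (intro negligible_Union finite_imageI finE; clarify)
    fix \<sigma> assume "\<sigma> \<in> E"
    then have "normal K \<sigma> \<noteq> 0" using flat_face.n[OF c] by fastforce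
    then show "negligible {z. normal K \<sigma> \<bullet> z = c \<sigma>}" by (simp add: negligible_hyperplane)
  qed
  then have neg: "negligible (N \<union> N0)" using N(1) by simp
  show thesis
  proof (rule that[OF neg])
    fix x assume xN: "x \<notin> N \<union> N0"
    then have x: "x \<notin> N" by simp
    define u where "u = (\<lambda>t. of_bool (x + t *\<^sub>R e \<in> K) :: real)"
    define h where "h = (\<lambda>\<sigma> t. of_bool (\<exists>r\<ge>t. x + r *\<^sub>R e \<in> \<sigma>) :: real)"
    define w where "w = (\<lambda>\<sigma>. sgn (normal K \<sigma> \<bullet> e))"
    define D where "D = (\<lambda>t. u t - (\<Sum>\<sigma>\<in>E. w \<sigma> * h \<sigma> t))"
    have transv: "normal K \<sigma> \<bullet> e \<noteq> 0" if "\<sigma> \<in> E" "x + t *\<^sub>R e \<in> \<sigma>" for \<sigma> t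
    proof -
      have "x + t *\<^sub>R e \<in> closure \<sigma>" using that(2) closure_subset by auto
      then show ?thesis using N(2)[OF x that(1)] by simp
    qed
    have uniq: "r = t" if s: "\<sigma> \<in> E" "x + t *\<^sub>R e \<in> \<sigma>" "x + r *\<^sub>R e \<in> \<sigma>" for \<sigma> t r
    proof -
      have "normal K \<sigma> \<bullet> z = c \<sigma>" if "z \<in> \<sigma>" for z
        using flat_face.subset[OF c[OF s(1)]] that by blast
      from this[OF s(2)] this[OF s(3)]
      have "normal K \<sigma> \<bullet> (x + t *\<^sub>R e) = normal K \<sigma> \<bullet> (x + r *\<^sub>R e)" by simp
      then show ?thesis using transv[OF s(1,2)] by (simp add: inner_add_right)
    qed
    \<comment> \<open>A transversal line meets a face at most once, so \<open>h \<sigma>\<close> is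
      a step function that drops from 1 to 0 just after the crossing.\<close>
    have h_hit: "h \<sigma> s = of_bool (s \<le> t)" if "\<sigma> \<in> E" "x + t *\<^sub>R e \<in> \<sigma>" for \<sigma> s t
    proof -
      have "(\<exists>r\<ge>s. x + r *\<^sub>R e \<in> \<sigma>) \<longleftrightarrow> s \<le> t" using uniq[OF that] that(2) by metis
      then show ?thesis by (simp add: h_def)
    qed
    have h_const: "\<forall>\<^sub>F s in nhds t. h \<sigma> s = h \<sigma> t" if s: "\<sigma> \<in> E" "x + t *\<^sub>R e \<notin> \<sigma>" for \<sigma> t
    proof (cases "\<exists>r. x + r *\<^sub>R e \<in> \<sigma>")
      case True
      then obtain r where r: "x + r *\<^sub>R e \<in> \<sigma>" by blast
      have "r \<noteq> t" using r s by auto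
      then consider "t < r" | "r < t" by linarith
      then show ?thesis
      proof cases
        case 1
        have "\<forall>\<^sub>F s in nhds t. s \<in> {..<r}" by (rule eventually_nhds_in_open) (use 1 in auto)
        then show ?thesis by eventually_elim (use 1 in \<open>simp add: h_hit[OF s(1) r]\<close>)
      next
        case 2
        have "\<forall>\<^sub>F s in nhds t. s \<in> {r<..}" by (rule eventually_nhds_in_open) (use 2 in auto)
        then show ?thesis by eventually_elim (use 2 in \<open>simp add: h_hit[OF s(1) r]\<close>)
      qed
    next
      case False
      then show ?thesis by (simp add: h_def)
    qed
    have regular: "\<forall>\<^sub>F s in nhds t. D s = D t" if t: "x + t *\<^sub>R e \<notin> frontier K" for t
    proof -
      have "\<forall>\<^sub>F s in nhds t. u s = u t"
      proof (cases "x + t *\<^sub>R e \<in> K")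
        case True
        have "\<forall>\<^sub>F s in nhds t. s \<in> {s. x + s *\<^sub>R e \<in> K}"
          by (rule eventually_nhds_in_open[OF open_line_preimage[OF openK]]) (use True in simp)
        then show ?thesis by eventually_elim (use True in \<open>simp add: u_def\<close>)
      next
        case False
        then have F: "x + t *\<^sub>R e \<in> - closure K"
          using t openK by (auto simp: frontier_def interior_open)
        have "\<forall>\<^sub>F s in nhds t. s \<in> {s. x + s *\<^sub>R e \<in> - closure K}"
          by (rule eventually_nhds_in_open[OF open_line_preimage]) (use F in auto)
        then show ?thesis
          by eventually_elim (use False closure_subset[of K] in \<open>auto simp: u_def\<close>)
      qed
      moreover have "\<forall>\<^sub>F s in nhds t. \<forall>\<sigma>\<in>E. h \<sigma> s = h \<sigma> t"
      proof (rule eventually_ball_finite[OF finE], rule ballI)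
        fix \<sigma> assume "\<sigma> \<in> E"
        moreover have "x + t *\<^sub>R e \<notin> \<sigma>" using t faces_frontier \<open>\<sigma> \<in> E\<close> by auto
        ultimately show "\<forall>\<^sub>F s in nhds t. h \<sigma> s = h \<sigma> t" by (rule h_const)
      qed
      ultimately show ?thesis
        by eventually_elim (simp add: D_def)
    qed
    have crossing: "\<exists>a. \<forall>\<^sub>F s in at t. D s = a" if t: "x + t *\<^sub>R e \<in> frontier K" for t
    proof -
      obtain \<sigma> where s: "\<sigma> \<in> E" "x + t *\<^sub>R e \<in> closure \<sigma>"
        using t frontier_faces by blast
      note good = N(2)[OF x s]
      have mem: "x + t *\<^sub>R e \<in> \<sigma>" and nz: "normal K \<sigma> \<bullet> e \<noteq> 0" using good by auto
      have other: "x + t *\<^sub>R e \<notin> closure \<sigma>'" if "\<sigma>' \<in> E" "\<sigma>' \<noteq> \<sigma>" for \<sigma>'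
        using good that by blast
      have "\<exists>\<delta>>0. ball (x + t *\<^sub>R e) \<delta> \<inter> frontier K \<subseteq> \<sigma>"
        by (rule isolated_face_point[OF s(1) c[OF s(1)] mem other])
      then obtain \<epsilon> where eps: "0 < \<epsilon>" "ball (x + t *\<^sub>R e) \<epsilon> \<inter> K =
          {y \<in> ball (x + t *\<^sub>R e) \<epsilon>. normal K \<sigma> \<bullet> (y - (x + t *\<^sub>R e)) < 0}"
        using outward_normal[OF s(1)] mem unfolding is_outward_unit_normal_def by blast
      have "\<forall>\<^sub>F s in nhds t. \<forall>\<sigma>'\<in>E - {\<sigma>}. h \<sigma>' s = h \<sigma>' t"
      proof (rule eventually_ball_finite, goal_cases)
        case 2
        show ?case
        proof
          fix \<sigma>' assume "\<sigma>' \<in> E - {\<sigma>}"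
          then have "\<sigma>' \<in> E" "x + t *\<^sub>R e \<notin> \<sigma>'"
            using other[of \<sigma>'] closure_subset[of \<sigma>'] by auto
          then show "\<forall>\<^sub>F s in nhds t. h \<sigma>' s = h \<sigma>' t" by (rule h_const)
        qed
      qed (use finE in simp)
      then have ev1: "\<forall>\<^sub>F s in at t. \<forall>\<sigma>'\<in>E - {\<sigma>}. h \<sigma>' s = h \<sigma>' t"
        by (simp add: eventually_at_filter eventually_mono)
      have ev2: "\<forall>\<^sub>F s in at t. s \<noteq> t" by (simp add: eventually_at_filter)
      have ev3: "\<forall>\<^sub>F s in at t. dist s t < \<epsilon>"
        using eps(1) by (auto simp: eventually_at)
      have "\<forall>\<^sub>F s in at t. D s = of_bool (normal K \<sigma> \<bullet> e < 0) - (\<Sum>\<sigma>'\<in>E - {\<sigma>}. w \<sigma>' * h \<sigma>' t)"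
        using ev1 ev2 ev3
      proof eventually_elim
        case (elim r)
        have "x + r *\<^sub>R e \<in> ball (x + t *\<^sub>R e) \<epsilon>"
        proof -
          have "(x + t *\<^sub>R e) - (x + r *\<^sub>R e) = (t - r) *\<^sub>R e" by (simp add: algebra_simps)
          then show ?thesis using elim(3) e by (simp add: dist_norm dist_commute abs_minus_commute)
        qed
        then have "x + r *\<^sub>R e \<in> K \<longleftrightarrow> normal K \<sigma> \<bullet> ((x + r *\<^sub>R e) - (x + t *\<^sub>R e)) < 0"
          using eps(2) by blast
        also have "(x + r *\<^sub>R e) - (x + t *\<^sub>R e) = (r - t) *\<^sub>R e" by (simp add: algebra_simps)
        also have "normal K \<sigma> \<bullet> ((r - t) *\<^sub>R e) < 0 \<longleftrightarrow> (if normal K \<sigma> \<bullet> e < 0 then t < r else r < t)"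
          using nz by (simp add: mult_less_0_iff)
        \<comment> \<open>The value is 1 on both sides of \<open>t\<close> if the line enters
          \<open>K\<close> there, and 0 on both sides if it leaves. At \<open>r = t\<close> itself
          this fails for a leaving line, where \<open>u\<close> is 0 but \<open>h \<sigma>\<close>
          is still 1; hence the punctured neighbourhood.\<close>
        finally have "u r - w \<sigma> * h \<sigma> r = of_bool (normal K \<sigma> \<bullet> e < 0)"
          using nz elim(2) by (auto simp: u_def w_def h_hit[OF s(1) mem] sgn_if)
        moreover have "(\<Sum>\<sigma>'\<in>E. w \<sigma>' * h \<sigma>' r) = w \<sigma> * h \<sigma> r + (\<Sum>\<sigma>'\<in>E - {\<sigma>}. w \<sigma>' * h \<sigma>' t)"
          using elim(1) by (simp add: sum.remove[OF finE s(1)])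
        ultimately show ?case by (simp add: D_def)
      qed
      then show ?thesis by blast
    qed
    have loc: "\<exists>a. \<forall>\<^sub>F s in at t. D s = a" for t
    proof (cases "x + t *\<^sub>R e \<in> frontier K")
      case False
      then show ?thesis
        using regular[OF False] by (auto simp: eventually_at_filter elim: eventually_mono)
    qed (rule crossing)
    have "bounded (closure K)" by (rule bounded_closure[OF boundedK])
    then obtain B where B: "\<And>y. y \<in> closure K \<Longrightarrow> norm y \<le> B" by (auto simp: bounded_iff)
    have far: "x + s *\<^sub>R e \<notin> closure K" if "B + norm x < s" for s
    proof
      assume "x + s *\<^sub>R e \<in> closure K"
      then have "norm (x + s *\<^sub>R e) \<le> B" by (rule B)
      moreover have "\<bar>s\<bar> \<le> norm (x + s *\<^sub>R e) + norm x"
        using norm_triangle_ineq4[of "x + s *\<^sub>R e" x] e by simp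
      ultimately show False using that by linarith
    qed
    have "D s = 0" if "B + norm x < s" for s
    proof -
      have "u s = 0" using far[OF that] closure_subset[of K] by (auto simp: u_def)
      moreover have "h \<sigma> s = 0" if "\<sigma> \<in> E" for \<sigma>
      proof -
        have "x + r *\<^sub>R e \<notin> \<sigma>" if "s \<le> r" for r
          using far[of r] \<open>B + norm x < s\<close> that faces_frontier \<open>\<sigma> \<in> E\<close> by (auto simp: frontier_def)
        then show ?thesis by (auto simp: h_def)
      qed
      ultimately show ?thesis by (simp add: D_def)
    qed
    then have ev0: "\<forall>\<^sub>F s in at 0. D s = 0"
      by (rule punctured_locally_constant_zero[OF loc])
    have "x \<notin> closure \<sigma>" if "\<sigma> \<in> E" for \<sigma>
      using flat_face.closure_subset[OF c[OF that]] xN that by (auto simp: N0_def)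
    then have "x + 0 *\<^sub>R e \<notin> frontier K" using frontier_faces by auto
    from regular[OF this] have "\<forall>\<^sub>F s in at 0. D s = D 0"
      by (auto simp: eventually_at_filter elim: eventually_mono)
    then have "\<forall>\<^sub>F s in at (0::real). D 0 = 0" using ev0 by eventually_elim simp
    then have "D 0 = 0" by simp
    then show "indicator K x = (\<Sum>\<sigma>\<in>E. sgn (normal K \<sigma> \<bullet> e) * indicator (shadow \<sigma> e) x)"
      by (simp add: D_def u_def h_def w_def indicator_def shadow_def of_bool_def)
  qed
qed

section \<open>The divergence theorem on a cell for linear fields\<close>

text \<open>Whole shadows can have infinite volume, so the indicator identity is integrated only
  after the cut at height \<open>-R\<close>. The cut lies strictly below \<open>K\<close>: both
  sides vanish beneath it, and every prism over a face has positive height.\<close>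

lemma measure_eq_sum_prisms:
  assumes e: "norm e = 1" and R: "\<And>x. x \<in> closure K \<Longrightarrow> - R < x \<bullet> e"
  shows "measure lebesgue K
    = (\<Sum>\<sigma>\<in>E. face_area \<sigma> * (normal K \<sigma> \<bullet> e) * (face_center \<sigma> \<bullet> e + R))"
proof -
  define Q where "Q = (\<lambda>\<sigma>. {x. \<exists>r. 0 \<le> r \<and> r \<le> (x + r *\<^sub>R e) \<bullet> e + R \<and> x + r *\<^sub>R e \<in> \<sigma>})"
  obtain c where c: "\<And>\<sigma>. \<sigma> \<in> E \<Longrightarrow> flat_face \<sigma> (normal K \<sigma>) (c \<sigma>)"
    using flat_face_normal by metis
  obtain N where N: "negligible N"
    "\<And>x. x \<notin> N \<Longrightarrow> indicator K x = (\<Sum>\<sigma>\<in>E. sgn (normal K \<sigma> \<bullet> e) * indicator (shadow \<sigma> e) x)"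
    using indicator_eq_sum_shadows[OF e] by blast
  have ee: "e \<bullet> e = 1" using e by (simp add: norm_eq_1)
  \<comment> \<open>As \<open>e\<close> is a unit vector, the bound on the length \<open>r\<close>
    is the same as requiring \<open>x\<close> to lie above the cut.\<close>
  have Q_eq: "x \<in> Q \<sigma> \<longleftrightarrow> - R \<le> x \<bullet> e \<and> x \<in> shadow \<sigma> e" for x \<sigma>
    by (auto simp: Q_def shadow_def inner_add_left ee)
  have ind: "indicator K x = (\<Sum>\<sigma>\<in>E. sgn (normal K \<sigma> \<bullet> e) * indicator (Q \<sigma>) x)" if "x \<notin> N" for x
  proof (cases "- R \<le> x \<bullet> e")
    case True
    then show ?thesis using N(2)[OF that] by (simp add: indicator_def Q_eq)
  next
    case False
    then have "x \<notin> K" using R[of x] closure_subset[of K] by force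
    then show ?thesis using False by (simp add: Q_eq)
  qed
  have faceK: "z \<in> closure K" if "\<sigma> \<in> E" "z \<in> \<sigma>" for \<sigma> z
    using faces_frontier that by (auto simp: frontier_def)
  have meas: "sgn (normal K \<sigma> \<bullet> e) * measure lebesgue (Q \<sigma>)
      = face_area \<sigma> * (normal K \<sigma> \<bullet> e) * (face_center \<sigma> \<bullet> e + R)
    \<and> integrable lebesgue (\<lambda>x. sgn (normal K \<sigma> \<bullet> e) * indicator (Q \<sigma>) x)"
    if s: "\<sigma> \<in> E" for \<sigma>
  proof (cases "normal K \<sigma> \<bullet> e = 0")
    \<comment> \<open>For a face parallel to \<open>e\<close> both sides vanish, since
      \<open>sgn 0 = 0\<close>; only transversal faces need the prism formula.\<close>
    case False
    interpret f: flat_face \<sigma> "normal K \<sigma>" "c \<sigma>" by (rule c[OF s])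
    have Qb: "Q \<sigma> \<in> sets borel"
      unfolding Q_def by (rule borel_prism[OF False f.borel f.subset])
    have "bounded (Q \<sigma>)"
    proof -
      obtain B where B: "\<And>y. y \<in> \<sigma> \<Longrightarrow> norm y \<le> B" using f.bounded by (auto simp: bounded_iff)
      have "norm x \<le> B + (B + \<bar>R\<bar>)" if xQ: "x \<in> Q \<sigma>" for x
      proof -
        obtain r where r: "0 \<le> r" "r \<le> (x + r *\<^sub>R e) \<bullet> e + R" "x + r *\<^sub>R e \<in> \<sigma>"
          using xQ by (auto simp: Q_def)
        have "(x + r *\<^sub>R e) \<bullet> e \<le> norm (x + r *\<^sub>R e) * norm e" by (rule norm_cauchy_schwarz)
        then have "r \<le> B + \<bar>R\<bar>" using B[OF r(3)] r(2) e by simp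
        moreover have "norm x \<le> norm (x + r *\<^sub>R e) + norm (r *\<^sub>R e)"
          using norm_triangle_ineq4[of "x + r *\<^sub>R e" "r *\<^sub>R e"] by simp
        ultimately show ?thesis using B[OF r(3)] r(1) e by simp
      qed
      then show ?thesis by (auto simp: bounded_iff)
    qed
    then have Ql: "Q \<sigma> \<in> lmeasurable" using Qb by (intro bounded_set_imp_lmeasurable) auto
    have pos: "0 < z \<bullet> e + R" if "z \<in> \<sigma>" for z
      using R[OF faceK[OF s that]] by simp
    have "measure lborel (Q \<sigma>) = \<bar>normal K \<sigma> \<bullet> e\<bar> * (face_area \<sigma> * (face_center \<sigma> \<bullet> e + R))"
      using prism_volume[OF f.n False f.borel f.bounded f.subset pos]
      unfolding unit_slab_def[symmetric] f.integral_affine_height Q_def .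
    then have "sgn (normal K \<sigma> \<bullet> e) * measure lebesgue (Q \<sigma>)
        = (sgn (normal K \<sigma> \<bullet> e) * \<bar>normal K \<sigma> \<bullet> e\<bar>) * (face_area \<sigma> * (face_center \<sigma> \<bullet> e + R))"
      using Qb by simp
    also have "sgn (normal K \<sigma> \<bullet> e) * \<bar>normal K \<sigma> \<bullet> e\<bar> = normal K \<sigma> \<bullet> e"
      by (rule sgn_mult_abs)
    finally have "sgn (normal K \<sigma> \<bullet> e) * measure lebesgue (Q \<sigma>)
        = face_area \<sigma> * (normal K \<sigma> \<bullet> e) * (face_center \<sigma> \<bullet> e + R)"
      by (simp only: mult.assoc mult.left_commute)
    moreover have "integrable lebesgue (\<lambda>x. indicator (Q \<sigma>) x :: real)"
      using Ql by (intro integrable_real_indicator) (auto simp: fmeasurable_def)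
    ultimately show ?thesis by simp
  qed simp
  have "measure lebesgue K = (LINT x|lebesgue. indicator K x)"
    using openK by simp
  also have "\<dots> = (LINT x|lebesgue. (\<Sum>\<sigma>\<in>E. sgn (normal K \<sigma> \<bullet> e) * indicator (Q \<sigma>) x))"
  proof (rule integral_cong_AE)
    have "N \<in> null_sets lebesgue" using N(1) by (simp add: negligible_iff_null_sets)
    then have "AE x in lebesgue. x \<notin> N" by (rule AE_not_in)
    then show "AE x in lebesgue. indicator K x = (\<Sum>\<sigma>\<in>E. sgn (normal K \<sigma> \<bullet> e) * indicator (Q \<sigma>) x)"
      by eventually_elim (rule ind)
    show "(\<lambda>x. \<Sum>\<sigma>\<in>E. sgn (normal K \<sigma> \<bullet> e) * indicator (Q \<sigma>) x) \<in> borel_measurable lebesgue"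
      using meas by (intro borel_measurable_sum) (blast intro: borel_measurable_integrable)
    show "(\<lambda>x. indicat_real K x) \<in> borel_measurable lebesgue"
      using openK by (intro borel_measurable_indicator) simp
  qed
  also have "\<dots> = (\<Sum>\<sigma>\<in>E. (LINT x|lebesgue. sgn (normal K \<sigma> \<bullet> e) * indicator (Q \<sigma>) x))"
    using meas by (intro Bochner_Integration.integral_sum) blast
  also have "\<dots> = (\<Sum>\<sigma>\<in>E. sgn (normal K \<sigma> \<bullet> e) * measure lebesgue (Q \<sigma>))"
    by simp
  also have "\<dots> = (\<Sum>\<sigma>\<in>E. face_area \<sigma> * (normal K \<sigma> \<bullet> e) * (face_center \<sigma> \<bullet> e + R))"
    using meas by (intro sum.cong) auto
  finally show ?thesis .
qed

text \<open>This is the divergence theorem for the field x \<mapsto> ((x - a) . v) v, whose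
  divergence is v . v and whose flux through a face is evaluated at the center of gravity. Prisms
  give it for unit vectors and homogeneity for all \<open>v\<close>; the point \<open>a\<close> is
  arbitrary because the total flux of a constant field vanishes.\<close>

lemma divergence_identity:
  "(\<Sum>\<sigma>\<in>E. face_area \<sigma> * (normal K \<sigma> \<bullet> v) * ((face_center \<sigma> - a) \<bullet> v)) = volume K * (v \<bullet> v)"
proof -
  have unit: "(\<Sum>\<sigma>\<in>E. face_area \<sigma> * (normal K \<sigma> \<bullet> e) * ((face_center \<sigma> - a) \<bullet> e)) = volume K"
    if e: "norm e = 1" for e
  proof -
    have "bounded (closure K)" by (rule bounded_closure[OF boundedK])
    then obtain B where B: "\<And>y. y \<in> closure K \<Longrightarrow> norm y \<le> B" by (auto simp: bounded_iff)
    have low: "- (B + 1) < x \<bullet> e" if "x \<in> closure K" for x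
      using B[OF that] Cauchy_Schwarz_ineq2[of x e] e by (simp add: abs_le_iff)
    let ?s = "\<lambda>\<sigma>. face_area \<sigma> * (normal K \<sigma> \<bullet> e)"
    have eq: "measure lebesgue K = (\<Sum>\<sigma>\<in>E. ?s \<sigma> * (face_center \<sigma> \<bullet> e)) + R * (\<Sum>\<sigma>\<in>E. ?s \<sigma>)"
      if "B + 1 \<le> R" for R
    proof -
      have "measure lebesgue K = (\<Sum>\<sigma>\<in>E. ?s \<sigma> * (face_center \<sigma> \<bullet> e + R))"
        by (rule measure_eq_sum_prisms[OF e]) (use low that in force)
      also have "\<dots> = (\<Sum>\<sigma>\<in>E. ?s \<sigma> * (face_center \<sigma> \<bullet> e)) + R * (\<Sum>\<sigma>\<in>E. ?s \<sigma>)"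
        unfolding sum_distrib_left sum.distrib[symmetric] by (intro sum.cong) (simp_all add: algebra_simps)
      finally show ?thesis .
    qed
    \<comment> \<open>the left-hand side does not depend on \<open>R\<close>\<close>
    have zero: "(\<Sum>\<sigma>\<in>E. ?s \<sigma>) = 0"
      using eq[of "B + 1"] eq[of "B + 2"] by (simp add: algebra_simps)
    have "(\<Sum>\<sigma>\<in>E. ?s \<sigma> * ((face_center \<sigma> - a) \<bullet> e))
        = (\<Sum>\<sigma>\<in>E. ?s \<sigma> * (face_center \<sigma> \<bullet> e)) - (\<Sum>\<sigma>\<in>E. ?s \<sigma>) * (a \<bullet> e)"
      by (simp add: inner_diff_left right_diff_distrib sum_subtractf sum_distrib_right)
    then show ?thesis using eq[of "B + 1"] zero by (simp add: volume_def)
  qed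
  show ?thesis
  proof (cases "v = 0")
    case False
    define e where "e = v /\<^sub>R norm v"
    have v: "v = norm v *\<^sub>R e" and e: "norm e = 1" using False by (simp_all add: e_def)
    have "(\<Sum>\<sigma>\<in>E. face_area \<sigma> * (normal K \<sigma> \<bullet> v) * ((face_center \<sigma> - a) \<bullet> v))
        = (norm v)\<^sup>2 * (\<Sum>\<sigma>\<in>E. face_area \<sigma> * (normal K \<sigma> \<bullet> e) * ((face_center \<sigma> - a) \<bullet> e))"
      by (subst (1 2) v) (simp add: sum_distrib_left power2_eq_square ac_simps)
    then show ?thesis using unit[OF e] by (simp add: power2_norm_eq_inner mult.commute)
  qed simp
qed

text \<open>When the vectors from \<open>a\<close> to the face centers are parallel to the normals,
  the form in \<open>divergence_identity\<close> becomes symmetric, and polarisation recovers it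
  from its diagonal.\<close>

lemma super_admissible_tensor:
  assumes adm: "\<And>\<sigma>. \<sigma> \<in> E \<Longrightarrow> face_center \<sigma> - a = d \<sigma> *\<^sub>R normal K \<sigma>"
  shows "(\<Sum>\<sigma>\<in>E. face_area \<sigma> * d \<sigma> * (normal K \<sigma> \<bullet> u) * (normal K \<sigma> \<bullet> v)) = volume K * (u \<bullet> v)"
proof -
  define B where "B = (\<lambda>u v. \<Sum>\<sigma>\<in>E. face_area \<sigma> * d \<sigma> * (normal K \<sigma> \<bullet> u) * (normal K \<sigma> \<bullet> v))"
  have diag: "B v v = volume K * (v \<bullet> v)" for v
    unfolding divergence_identity[of v a, symmetric] B_def
    by (intro sum.cong) (simp_all add: adm)
  have "B (u + v) (u + v) = B u u + 2 * B u v + B v v"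
    unfolding B_def sum_distrib_left sum.distrib[symmetric]
    by (intro sum.cong) (simp_all add: inner_add_right algebra_simps)
  then have "B u v = volume K * (u \<bullet> v)"
    unfolding diag by (simp add: inner_simps algebra_simps inner_commute)
  then show ?thesis by (simp add: B_def)
qed

end

section \<open>Two-point fluxes\<close>

lemma polytopal_mesh_cell:
  assumes "polytopal_mesh \<Omega> \<M> \<E>" "K \<in> \<M>"
  shows "polytopal_cell K (\<E> K)"
  using assms by (auto simp: polytopal_mesh_def polytopal_cell_def polytopal_def[of K])

text \<open>On \<Omega> the scalar \<open>lam\<close> is a diagonal entry of \<Lambda>, from which
  it inherits measurability and boundedness; ellipticity tested on a coordinate vector bounds it
  below by \<zeta> almost everywhere.\<close>

lemma isotropic_mean_value:
  fixes \<Lambda> :: "real^'d \<Rightarrow> real^'d^'d"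
  assumes \<Lambda>: "diffusion_tensor \<Omega> \<Lambda>" "\<And>x. x \<in> \<Omega> \<Longrightarrow> \<Lambda> x = lam x *\<^sub>R mat 1"
    and K: "open K" "bounded K" "K \<noteq> {}" "K \<subseteq> \<Omega>"
  shows "mean_value K \<Lambda> = mean_value K lam *\<^sub>R mat 1" and "0 < mean_value K lam"
    and "0 < volume K"
proof -
  fix i :: 'd
  have Kl: "K \<in> lmeasurable" using K by (simp add: lmeasurable_open)
  then have Ks: "K \<in> sets lebesgue" by auto
  show vol: "0 < volume K"
    using open_not_negligible[OF K(1,3)] negligible_iff_measure[of K] Kl
    by (simp add: volume_def less_le)
  have entry: "lam x = \<Lambda> x $ i $ i" if "x \<in> \<Omega>" for x
    using \<Lambda>(2)[OF that] by (simp add: mat_def)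
  have "(\<lambda>x. indicator \<Omega> x *\<^sub>R \<Lambda> x) \<in> borel_measurable lebesgue"
    using \<Lambda>(1) by (simp add: diffusion_tensor_def set_borel_measurable_def)
  then have "(\<lambda>x. (indicator \<Omega> x *\<^sub>R \<Lambda> x) $ i $ i) \<in> borel_measurable lebesgue"
    by (rule measurable_compose) (intro borel_measurable_continuous_onI continuous_intros)
  then have "(\<lambda>x. indicator K x * (indicator \<Omega> x *\<^sub>R \<Lambda> x) $ i $ i) \<in> borel_measurable lebesgue"
    using Ks by (intro borel_measurable_times borel_measurable_indicator)
  moreover have "(\<lambda>x. indicator K x * (indicator \<Omega> x *\<^sub>R \<Lambda> x) $ i $ i) = (\<lambda>x. indicator K x * lam x)"
    using K(4) entry by (auto simp: indicator_def fun_eq_iff)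
  ultimately have meas: "(\<lambda>x. indicator K x * lam x) \<in> borel_measurable lebesgue" by simp
  obtain B where B: "\<And>x. x \<in> \<Omega> \<Longrightarrow> norm (\<Lambda> x) \<le> B"
    using \<Lambda>(1) by (auto simp: diffusion_tensor_def bounded_iff)
  have lamB: "\<bar>lam x\<bar> \<le> B" if "x \<in> \<Omega>" for x
    unfolding entry[OF that] using component_le_norm_cart[of "\<Lambda> x $ i" i]
      Finite_Cartesian_Product.norm_nth_le[of "\<Lambda> x" i] B[OF that] by linarith
  have intB: "integrable lebesgue (\<lambda>x. indicator K x * b)" for b :: real
    using Kl by (intro integrable_mult_left integrable_real_indicator) (auto simp: fmeasurable_def)
  have int: "integrable lebesgue (\<lambda>x. indicator K x * lam x)"
  proof (rule Bochner_Integration.integrable_bound[OF intB[of B] meas], rule AE_I2)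
    fix x
    show "norm (indicator K x * lam x) \<le> norm (indicator K x * B)"
      using lamB[of x] K(4) by (auto simp: indicator_def)
  qed
  have "(LINT x:K|lebesgue. \<Lambda> x) = (LINT x|lebesgue. (indicator K x * lam x) *\<^sub>R mat 1)"
    unfolding set_lebesgue_integral_def
    by (rule Bochner_Integration.integral_cong) (use K(4) \<Lambda>(2) in \<open>auto simp: indicator_def\<close>)
  also have "\<dots> = (LINT x|lebesgue. indicator K x * lam x) *\<^sub>R mat 1"
    using int by (intro integral_scaleR_left)
  finally show "mean_value K \<Lambda> = mean_value K lam *\<^sub>R mat 1"
    by (simp add: mean_value_def set_lebesgue_integral_def)
  obtain \<zeta> where \<zeta>: "0 < \<zeta>"
    "AE x in lebesgue. x \<in> \<Omega> \<longrightarrow> (\<forall>\<xi>. (\<Lambda> x *v \<xi>) \<bullet> \<xi> \<ge> \<zeta> * (norm \<xi>)\<^sup>2)"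
    using \<Lambda>(1) by (auto simp: diffusion_tensor_def)
  have "AE x in lebesgue. indicator K x * \<zeta> \<le> indicator K x * lam x"
    using \<zeta>(2)
  proof eventually_elim
    case (elim x)
    show ?case
    proof (cases "x \<in> K")
      case True
      then have x: "x \<in> \<Omega>" using K(4) by blast
      then have "\<zeta> * (norm (axis i 1 :: real^'d))\<^sup>2 \<le> (\<Lambda> x *v axis i 1) \<bullet> axis i 1" using elim by blast
      also have "(\<Lambda> x *v axis i 1) \<bullet> axis i 1 = lam x"
        by (simp add: \<Lambda>(2)[OF x] scaleR_matrix_vector_assoc[symmetric] inner_axis_axis)
      finally show ?thesis using True by (simp add: norm_axis_1)
    qed simp
  qed
  then have "(LINT x|lebesgue. indicator K x * \<zeta>) \<le> (LINT x|lebesgue. indicator K x * lam x)"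
    by (rule integral_mono_AE[OF intB int])
  moreover have "(LINT x|lebesgue. indicator K x * \<zeta>) = volume K * \<zeta>"
    using Ks by (simp add: volume_def)
  ultimately have "0 < (LINT x|lebesgue. indicator K x * lam x)"
    using mult_pos_pos[OF vol \<zeta>(1)] by linarith
  then show "0 < mean_value K lam"
    using vol by (simp add: mean_value_def set_lebesgue_integral_def)
qed

lemma matrix_form_diagonal:
  assumes "finite I" "\<And>i j. i \<in> I \<Longrightarrow> j \<in> I \<Longrightarrow> B i j = (if i = j then b i else 0)"
  shows "matrix_form I u B v = (\<Sum>i\<in>I. b i * u i * v i)"
proof -
  have "(\<Sum>j\<in>I. u i * B i j * v j) = b i * u i * v i" if "i \<in> I" for i
  proof -
    have "(\<Sum>j\<in>I. u i * B i j * v j) = (\<Sum>j\<in>I. if i = j then b i * u i * v i else 0)"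
      by (rule sum.cong) (auto simp: assms(2) that)
    then show ?thesis using assms(1) that by simp
  qed
  then show ?thesis by (simp add: matrix_form_def)
qed

section \<open>Diagonalisation of the two local bilinear forms\<close>

locale super_admissible_cell = polytopal_cell K "\<E> K"
  for K :: "'d::finite cell" and \<E> :: "'d cell \<Rightarrow> 'd face set" +
  fixes xc :: "'d cell \<Rightarrow> real^'d" and \<Lambda> :: "real^'d \<Rightarrow> real^'d^'d" and \<mu> :: real
  assumes dist_pos: "\<And>\<sigma>. \<sigma> \<in> \<E> K \<Longrightarrow> 0 < face_dist (xc K) \<sigma>"
    and admissible: "\<And>\<sigma>. \<sigma> \<in> \<E> K \<Longrightarrow> face_center \<sigma> - xc K = face_dist (xc K) \<sigma> *\<^sub>R normal K \<sigma>"
    and volume_pos: "0 < volume K"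
    and mu_pos: "0 < \<mu>"
    and mean: "mean_value K \<Lambda> = \<mu> *\<^sub>R mat 1"
begin

abbreviation d where "d \<sigma> \<equiv> face_dist (xc K) \<sigma>"

lemma mean_mult: "mean_value K \<Lambda> *v v = \<mu> *\<^sub>R v"
  by (simp add: mean scaleR_matrix_vector_assoc[symmetric])

lemma area_pos: "\<sigma> \<in> \<E> K \<Longrightarrow> 0 < face_area \<sigma>"
  using flat_face_normal flat_face.face_area_pos by blast

lemma tensor:
  "(\<Sum>\<sigma>\<in>\<E> K. face_area \<sigma> * d \<sigma> * (normal K \<sigma> \<bullet> u) * (normal K \<sigma> \<bullet> v)) = volume K * (u \<bullet> v)"
  by (rule super_admissible_tensor[OF admissible])

lemma grad_inner:
  "(\<Sum>\<sigma>\<in>\<E> K. face_area \<sigma> * (snd p \<sigma> - fst p) * (normal K \<sigma> \<bullet> w)) = volume K * (grad \<E> K p \<bullet> w)"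
  using volume_pos by (simp add: grad_def inner_sum_left)

text \<open>Expanding the product of the residuals gives two cross terms, each equal to -\<mu> |K|
  times the product of the gradients by \<open>grad_inner\<close>, and a quadratic term equal to
  +\<mu> |K| times that product by \<open>tensor\<close>. Together they cancel the consistent
  term.\<close>

lemma hybrid_form_two_point:
  assumes B: "\<And>\<sigma> \<sigma>'. \<sigma> \<in> \<E> K \<Longrightarrow> \<sigma>' \<in> \<E> K \<Longrightarrow>
    B \<sigma> \<sigma>' = (if \<sigma> = \<sigma>' then face_area \<sigma> * \<mu> / d \<sigma> else 0)"
  shows "volume K * ((mean_value K \<Lambda> *v grad \<E> K p) \<bullet> grad \<E> K q)
      + matrix_form (\<E> K) (hybrid_residual \<E> xc K q) B (hybrid_residual \<E> xc K p)
    = (\<Sum>\<sigma>\<in>\<E> K. face_area \<sigma> * \<mu> / d \<sigma> * (snd q \<sigma> - fst q) * (snd p \<sigma> - fst p))"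
proof -
  let ?gp = "grad \<E> K p" and ?gq = "grad \<E> K q"
  let ?a = "\<lambda>\<sigma>. face_area \<sigma>" and ?n = "\<lambda>\<sigma>. normal K \<sigma>"
  let ?dp = "\<lambda>\<sigma>. snd p \<sigma> - fst p" and ?dq = "\<lambda>\<sigma>. snd q \<sigma> - fst q"
  have res: "hybrid_residual \<E> xc K r \<sigma> = (snd r \<sigma> - fst r) - d \<sigma> * (?n \<sigma> \<bullet> grad \<E> K r)"
    if "\<sigma> \<in> \<E> K" for r \<sigma>
    by (simp add: hybrid_residual_def admissible[OF that] inner_commute)
  have "matrix_form (\<E> K) (hybrid_residual \<E> xc K q) B (hybrid_residual \<E> xc K p)
      = (\<Sum>\<sigma>\<in>\<E> K. ?a \<sigma> * \<mu> / d \<sigma> * (?dq \<sigma> - d \<sigma> * (?n \<sigma> \<bullet> ?gq)) * (?dp \<sigma> - d \<sigma> * (?n \<sigma> \<bullet> ?gp)))"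
    by (subst matrix_form_diagonal[OF finE B]) (auto simp: res)
  also have "\<dots> = (\<Sum>\<sigma>\<in>\<E> K. ?a \<sigma> * \<mu> / d \<sigma> * ?dq \<sigma> * ?dp \<sigma>
      - \<mu> * (?a \<sigma> * ?dq \<sigma> * (?n \<sigma> \<bullet> ?gp)) - \<mu> * (?a \<sigma> * ?dp \<sigma> * (?n \<sigma> \<bullet> ?gq))
      + \<mu> * (?a \<sigma> * d \<sigma> * (?n \<sigma> \<bullet> ?gq) * (?n \<sigma> \<bullet> ?gp)))"
  proof (rule sum.cong[OF refl])
    fix \<sigma> assume "\<sigma> \<in> \<E> K"
    then have "d \<sigma> \<noteq> 0" using dist_pos by fastforce
    then show "?a \<sigma> * \<mu> / d \<sigma> * (?dq \<sigma> - d \<sigma> * (?n \<sigma> \<bullet> ?gq)) * (?dp \<sigma> - d \<sigma> * (?n \<sigma> \<bullet> ?gp))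
      = ?a \<sigma> * \<mu> / d \<sigma> * ?dq \<sigma> * ?dp \<sigma>
      - \<mu> * (?a \<sigma> * ?dq \<sigma> * (?n \<sigma> \<bullet> ?gp)) - \<mu> * (?a \<sigma> * ?dp \<sigma> * (?n \<sigma> \<bullet> ?gq))
      + \<mu> * (?a \<sigma> * d \<sigma> * (?n \<sigma> \<bullet> ?gq) * (?n \<sigma> \<bullet> ?gp))"
      by (simp add: field_simps)
  qed
  also have "\<dots> = (\<Sum>\<sigma>\<in>\<E> K. ?a \<sigma> * \<mu> / d \<sigma> * ?dq \<sigma> * ?dp \<sigma>)
      - \<mu> * (volume K * (?gq \<bullet> ?gp)) - \<mu> * (volume K * (?gp \<bullet> ?gq)) + \<mu> * (volume K * (?gq \<bullet> ?gp))"
    by (simp only: sum.distrib sum_subtractf sum_distrib_left[symmetric] grad_inner tensor)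
  finally show ?thesis
    by (simp add: mean_mult inner_commute)
qed

text \<open>The mean tensor is a positive multiple of the identity, so the equation in the definite
  description has exactly one solution.\<close>

lemma flux_vector_eq:
  "flux_vector \<Lambda> \<E> xc K G =
    - (1 / (volume K * \<mu>)) *\<^sub>R (\<Sum>\<sigma>\<in>\<E> K. (face_area \<sigma> * G \<sigma>) *\<^sub>R (face_center \<sigma> - xc K))"
  unfolding flux_vector_def mean_mult
proof (rule the_equality)
  let ?s = "\<Sum>\<sigma>\<in>\<E> K. (face_area \<sigma> * G \<sigma>) *\<^sub>R (face_center \<sigma> - xc K)"
  have nz: "volume K \<noteq> 0" "\<mu> \<noteq> 0" using volume_pos mu_pos by auto
  then show "volume K *\<^sub>R \<mu> *\<^sub>R - (1 / (volume K * \<mu>)) *\<^sub>R ?s = - ?s" by simp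
  fix v assume "volume K *\<^sub>R \<mu> *\<^sub>R v = - ?s"
  then have "(1 / (volume K * \<mu>)) *\<^sub>R (volume K *\<^sub>R \<mu> *\<^sub>R v) = (1 / (volume K * \<mu>)) *\<^sub>R (- ?s)" by simp
  then show "v = - (1 / (volume K * \<mu>)) *\<^sub>R ?s" using nz by simp
qed

text \<open>The counterpart of \<open>grad_inner\<close> for the mixed scheme: it evaluates the
  cross terms, with the minus sign that produces the cancellation.\<close>

lemma flux_vector_inner:
  "(\<Sum>\<sigma>\<in>\<E> K. face_area \<sigma> * d \<sigma> * G \<sigma> * (normal K \<sigma> \<bullet> w))
    = - (volume K * \<mu> * (flux_vector \<Lambda> \<E> xc K G \<bullet> w))"
proof -
  have "volume K * \<mu> * (flux_vector \<Lambda> \<E> xc K G \<bullet> w)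
      = - (\<Sum>\<sigma>\<in>\<E> K. (face_area \<sigma> * G \<sigma>) *\<^sub>R (face_center \<sigma> - xc K)) \<bullet> w"
    using volume_pos mu_pos by (simp add: flux_vector_eq)
  also have "\<dots> = - (\<Sum>\<sigma>\<in>\<E> K. face_area \<sigma> * d \<sigma> * G \<sigma> * (normal K \<sigma> \<bullet> w))"
    by (simp add: inner_sum_left admissible ac_simps)
  finally show ?thesis by simp
qed

text \<open>The cancellation is that of the hybrid form: each cross term is -\<mu> |K| times the
  product of the flux vectors, while the consistent and the quadratic term each contribute the
  opposite.\<close>

lemma mixed_form_two_point:
  assumes B: "\<And>\<sigma> \<sigma>'. \<sigma> \<in> \<E> K \<Longrightarrow> \<sigma>' \<in> \<E> K \<Longrightarrow>
    B \<sigma> \<sigma>' = (if \<sigma> = \<sigma>' then face_area \<sigma> * (d \<sigma> / \<mu>) else 0)"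
  shows "volume K * (flux_vector \<Lambda> \<E> xc K F \<bullet> (mean_value K \<Lambda> *v flux_vector \<Lambda> \<E> xc K G))
      + matrix_form (\<E> K) (mixed_residual \<Lambda> \<E> xc K G) B (mixed_residual \<Lambda> \<E> xc K F)
    = (\<Sum>\<sigma>\<in>\<E> K. face_area \<sigma> * (d \<sigma> / \<mu>) * G \<sigma> * F \<sigma>)"
proof -
  let ?vF = "flux_vector \<Lambda> \<E> xc K F" and ?vG = "flux_vector \<Lambda> \<E> xc K G"
  let ?a = "\<lambda>\<sigma>. face_area \<sigma>" and ?n = "\<lambda>\<sigma>. normal K \<sigma>"
  have res: "mixed_residual \<Lambda> \<E> xc K H \<sigma> = H \<sigma> + \<mu> * (?n \<sigma> \<bullet> flux_vector \<Lambda> \<E> xc K H)" for H \<sigma>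
    by (simp add: mixed_residual_def mean_mult inner_commute)
  have "matrix_form (\<E> K) (mixed_residual \<Lambda> \<E> xc K G) B (mixed_residual \<Lambda> \<E> xc K F)
      = (\<Sum>\<sigma>\<in>\<E> K. ?a \<sigma> * (d \<sigma> / \<mu>) * (G \<sigma> + \<mu> * (?n \<sigma> \<bullet> ?vG)) * (F \<sigma> + \<mu> * (?n \<sigma> \<bullet> ?vF)))"
    by (subst matrix_form_diagonal[OF finE B]) (auto simp: res)
  also have "\<dots> = (\<Sum>\<sigma>\<in>\<E> K. ?a \<sigma> * (d \<sigma> / \<mu>) * G \<sigma> * F \<sigma>
      + ?a \<sigma> * d \<sigma> * G \<sigma> * (?n \<sigma> \<bullet> ?vF) + ?a \<sigma> * d \<sigma> * F \<sigma> * (?n \<sigma> \<bullet> ?vG)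
      + \<mu> * (?a \<sigma> * d \<sigma> * (?n \<sigma> \<bullet> ?vG) * (?n \<sigma> \<bullet> ?vF)))"
    by (rule sum.cong[OF refl]) (use mu_pos in \<open>simp add: field_simps\<close>)
  also have "\<dots> = (\<Sum>\<sigma>\<in>\<E> K. ?a \<sigma> * (d \<sigma> / \<mu>) * G \<sigma> * F \<sigma>)
      + - (volume K * \<mu> * (?vG \<bullet> ?vF)) + - (volume K * \<mu> * (?vF \<bullet> ?vG)) + \<mu> * (volume K * (?vG \<bullet> ?vF))"
    by (simp only: sum.distrib sum_distrib_left[symmetric] flux_vector_inner[of G] flux_vector_inner[of F] tensor)
  finally show ?thesis
    by (simp add: mean_mult inner_commute)
qed

lemma hybrid_flux:
  assumes B: "\<And>\<sigma> \<sigma>'. \<sigma> \<in> \<E> K \<Longrightarrow> \<sigma>' \<in> \<E> K \<Longrightarrow>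
      B \<sigma> \<sigma>' = (if \<sigma> = \<sigma>' then face_area \<sigma> * \<mu> / d \<sigma> else 0)"
    and eq: "\<And>q :: 'd local_family. (\<Sum>\<sigma>\<in>\<E> K. face_area \<sigma> * F \<sigma> * (fst q - snd q \<sigma>)) =
        volume K * ((mean_value K \<Lambda> *v grad \<E> K p) \<bullet> grad \<E> K q)
        + matrix_form (\<E> K) (hybrid_residual \<E> xc K q) B (hybrid_residual \<E> xc K p)"
    and s: "\<sigma> \<in> \<E> K"
  shows "F \<sigma> = \<mu> / d \<sigma> * (fst p - snd p \<sigma>)"
proof -
  \<comment> \<open>The value -1 on \<open>\<sigma>\<close> makes
    \<open>fst q - snd q \<sigma>\<close> equal to 1 and leaves all other differences zero, so only
    the flux through \<open>\<sigma>\<close> survives.\<close>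
  define q :: "'d local_family" where "q = (0, \<lambda>\<sigma>'. if \<sigma>' = \<sigma> then -1 else 0)"
  have "(\<Sum>\<sigma>'\<in>\<E> K. face_area \<sigma>' * F \<sigma>' * (fst q - snd q \<sigma>'))
      = (\<Sum>\<sigma>'\<in>\<E> K. face_area \<sigma>' * \<mu> / d \<sigma>' * (snd q \<sigma>' - fst q) * (snd p \<sigma>' - fst p))"
    unfolding eq by (rule hybrid_form_two_point[OF B])
  then have "face_area \<sigma> * F \<sigma> = - (face_area \<sigma> * \<mu> / d \<sigma> * (snd p \<sigma> - fst p))"
    using s finE by (simp add: q_def if_distrib[of "\<lambda>x. _ * x"] if_distrib[of "\<lambda>x. x * _"]
      if_distrib[of uminus] sum.delta cong: if_cong)
  then have "face_area \<sigma> * F \<sigma> = face_area \<sigma> * (\<mu> / d \<sigma> * (fst p - snd p \<sigma>))"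
    by (simp add: algebra_simps diff_divide_distrib)
  then show ?thesis using area_pos[OF s] by (metis mult_left_cancel less_irrefl)
qed

lemma mixed_flux:
  assumes B: "\<And>\<sigma> \<sigma>'. \<sigma> \<in> \<E> K \<Longrightarrow> \<sigma>' \<in> \<E> K \<Longrightarrow>
      B \<sigma> \<sigma>' = (if \<sigma> = \<sigma>' then face_area \<sigma> * (d \<sigma> / \<mu>) else 0)"
    and eq: "\<And>G :: 'd face \<Rightarrow> real.
        volume K * (flux_vector \<Lambda> \<E> xc K F \<bullet> (mean_value K \<Lambda> *v flux_vector \<Lambda> \<E> xc K G))
        + matrix_form (\<E> K) (mixed_residual \<Lambda> \<E> xc K G) B (mixed_residual \<Lambda> \<E> xc K F)
        = (\<Sum>\<sigma>\<in>\<E> K. (fst p - snd p \<sigma>) * face_area \<sigma> * G \<sigma>)"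
    and s: "\<sigma> \<in> \<E> K"
  shows "F \<sigma> = \<mu> / d \<sigma> * (fst p - snd p \<sigma>)"
proof -
  define G :: "'d face \<Rightarrow> real" where "G = (\<lambda>\<sigma>'. if \<sigma>' = \<sigma> then 1 else 0)"
  have "(\<Sum>\<sigma>'\<in>\<E> K. face_area \<sigma>' * (d \<sigma>' / \<mu>) * G \<sigma>' * F \<sigma>')
      = (\<Sum>\<sigma>'\<in>\<E> K. (fst p - snd p \<sigma>') * face_area \<sigma>' * G \<sigma>')"
    unfolding eq[symmetric] by (rule mixed_form_two_point[OF B, symmetric])
  then have "face_area \<sigma> * (d \<sigma> / \<mu>) * F \<sigma> = (fst p - snd p \<sigma>) * face_area \<sigma>"
    using s finE by (simp add: G_def if_distrib[of "\<lambda>x. _ * x"] if_distrib[of "\<lambda>x. x * _"]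
      sum.delta cong: if_cong)
  then have "face_area \<sigma> * (d \<sigma> / \<mu> * F \<sigma>) = face_area \<sigma> * (fst p - snd p \<sigma>)"
    by (simp only: mult.assoc mult.commute[of "face_area \<sigma>"])
  then have "d \<sigma> / \<mu> * F \<sigma> = fst p - snd p \<sigma>"
    using area_pos[OF s] by (metis mult_left_cancel less_irrefl)
  then show ?thesis using dist_pos[OF s] mu_pos by (simp add: field_simps)
qed

end

section \<open>Elimination of the face value\<close>

text \<open>Resistances in series: \<open>s / a\<close> and \<open>t / b\<close> add up between
  \<open>p\<close> and \<open>q\<close>. Combining the two flux laws with weights \<open>b\<close>
  and \<open>-a\<close> removes the face value \<open>r\<close>, and \<open>G = -F\<close> leaves an
  equation for \<open>F\<close> alone.\<close>

lemma harmonic_flux: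
  fixes a b :: real
  assumes pos: "0 < a" "0 < b" "0 < s" "0 < t"
    and F: "F = a / s * (p - r)" "G = b / t * (q - r)" "F + G = 0"
  shows "F = a * b / (s * b + t * a) * (p - q)"
proof -
  have Fs: "F * s = a * (p - r)" and Gt: "G * t = b * (q - r)" using F(1,2) pos by simp_all
  have "F * (s * b + t * a) = b * (F * s) - a * (G * t)"
    using F(3) by (simp add: algebra_simps eq_neg_iff_add_eq_0[symmetric])
  also have "\<dots> = a * b * (p - q)" unfolding Fs Gt by (simp add: algebra_simps)
  finally have "F * (s * b + t * a) = a * b * (p - q)" .
  moreover have "0 < s * b + t * a" using pos by (simp add: add_pos_pos)
  ultimately show ?thesis by (simp add: field_simps)
qed

theorem mainTheorem4:
  fixes \<Omega> :: "(real^'d) set"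
    and f :: "real^'d \<Rightarrow> real"
    and \<Lambda> :: "real^'d \<Rightarrow> real^'d^'d"
    and lam :: "real^'d \<Rightarrow> real"
    and \<M> :: "'d cell set"
    and \<E> :: "'d cell \<Rightarrow> 'd face set"
    and xc :: "'d cell \<Rightarrow> real^'d"
    and lamK :: "'d cell \<Rightarrow> real"
    and BH BM :: "'d cell \<Rightarrow> 'd face \<Rightarrow> 'd face \<Rightarrow> real"
    and p :: "'d family"
    and F :: "'d fluxes"
  assumes "open \<Omega>" and "polytopal \<Omega>"
    and "square_integrable_on f \<Omega>"
    and "diffusion_tensor \<Omega> \<Lambda>"
    and "\<And>x. x \<in> \<Omega> \<Longrightarrow> \<Lambda> x = lam x *\<^sub>R mat 1"
    and "polytopal_mesh \<Omega> \<M> \<E>"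
    and "cell_points \<M> \<E> xc"
    and "super_admissible \<M> \<E> xc"
    and "\<And>K. K \<in> \<M> \<Longrightarrow> lamK K = mean_value K lam"
    and "\<And>K \<sigma> \<sigma>'. \<lbrakk>K \<in> \<M>; \<sigma> \<in> \<E> K; \<sigma>' \<in> \<E> K\<rbrakk> \<Longrightarrow>
           BH K \<sigma> \<sigma>' = (if \<sigma> = \<sigma>' then face_area \<sigma> * lamK K / face_dist (xc K) \<sigma> else 0)"
    and "\<And>K \<sigma> \<sigma>'. \<lbrakk>K \<in> \<M>; \<sigma> \<in> \<E> K; \<sigma>' \<in> \<E> K\<rbrakk> \<Longrightarrow>
           BM K \<sigma> \<sigma>' = (if \<sigma> = \<sigma>' then face_area \<sigma> * (face_dist (xc K) \<sigma> / lamK K) else 0)"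
    and "generalized_hybrid_solution \<Omega> f \<Lambda> \<M> \<E> xc BH p F
         \<or> modified_mixed_solution \<Omega> f \<Lambda> \<M> \<E> xc BM p F"
  shows "(\<forall>K\<in>\<M>. \<forall>\<sigma>\<in>\<E> K.
            F K \<sigma> = lamK K / face_dist (xc K) \<sigma> * (fst p K - snd p \<sigma>)) \<and>
         (\<forall>\<sigma> K L. interior_face_between \<Omega> \<M> \<E> \<sigma> K L \<longrightarrow>
           F K \<sigma> = lamK K * lamK L
                    / (face_dist (xc K) \<sigma> * lamK L + face_dist (xc L) \<sigma> * lamK K)
                    * (fst p K - fst p L))"
proof -
  have cell: "super_admissible_cell K \<E> xc \<Lambda> (lamK K)" if K: "K \<in> \<M>" for K
  proof -
    interpret polytopal_cell K "\<E> K"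
      by (rule polytopal_mesh_cell[OF assms(6) K])
    have KO: "K \<noteq> {}" "K \<subseteq> \<Omega>" using assms(6) K by (auto simp: polytopal_mesh_def)
    note mean = isotropic_mean_value[OF assms(4,5) openK boundedK KO]
    show ?thesis
    proof
      fix \<sigma> assume s: "\<sigma> \<in> \<E> K"
      show pos: "0 < face_dist (xc K) \<sigma>"
        using assms(7) K s by (auto simp: cell_points_def)
      show "face_center \<sigma> - xc K = face_dist (xc K) \<sigma> *\<^sub>R normal K \<sigma>"
        using assms(8) K s pos by (simp add: super_admissible_def)
    qed (use mean assms(9)[OF K] in simp_all)
  qed
  have flux: "F K \<sigma> = lamK K / face_dist (xc K) \<sigma> * (fst p K - snd p \<sigma>)"
    if K: "K \<in> \<M>" and s: "\<sigma> \<in> \<E> K" for K \<sigma>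
  proof -
    interpret super_admissible_cell K \<E> xc \<Lambda> "lamK K" by (rule cell[OF K])
    from assms(12) show ?thesis
    proof
      assume "generalized_hybrid_solution \<Omega> f \<Lambda> \<M> \<E> xc BH p F"
      then have "F K \<sigma> = lamK K / face_dist (xc K) \<sigma> * (fst (localize p K) - snd (localize p K) \<sigma>)"
        using K by (intro hybrid_flux[OF assms(10)[OF K] _ s])
          (auto simp: generalized_hybrid_solution_def)
      then show ?thesis by (simp add: localize_def)
    next
      assume "modified_mixed_solution \<Omega> f \<Lambda> \<M> \<E> xc BM p F"
      then have "F K \<sigma> = lamK K / face_dist (xc K) \<sigma> * (fst (localize p K) - snd (localize p K) \<sigma>)"
        using K by (intro mixed_flux[OF assms(11)[OF K] _ s])
          (auto simp: modified_mixed_solution_def localize_def)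
      then show ?thesis by (simp add: localize_def)
    qed
  qed
  moreover have "F K \<sigma> = lamK K * lamK L
      / (face_dist (xc K) \<sigma> * lamK L + face_dist (xc L) \<sigma> * lamK K) * (fst p K - fst p L)"
    if "interior_face_between \<Omega> \<M> \<E> \<sigma> K L" for \<sigma> K L
  proof -
    have KL: "K \<in> \<M>" "L \<in> \<M>" and s: "\<sigma> \<in> \<E> K" "\<sigma> \<in> \<E> L"
      using that by (auto simp: interior_face_between_def)
    interpret K: super_admissible_cell K \<E> xc \<Lambda> "lamK K" by (rule cell[OF KL(1)])
    interpret L: super_admissible_cell L \<E> xc \<Lambda> "lamK L" by (rule cell[OF KL(2)])
    \<comment> \<open>Conservation across interior faces is built into \<open>flux_space\<close>, to
      which the fluxes of either scheme belong.\<close>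
    have "F K \<sigma> + F L \<sigma> = 0"
      using assms(12) that
      by (auto simp: generalized_hybrid_solution_def modified_mixed_solution_def flux_space_def)
    then show ?thesis
      by (rule harmonic_flux[OF K.mu_pos L.mu_pos K.dist_pos[OF s(1)] L.dist_pos[OF s(2)]
            flux[OF KL(1) s(1)] flux[OF KL(2) s(2)]])
  qed
  ultimately show ?thesis by blast
qed

end
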